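(* Let $H_1,H_2\in \mathrm{M}(n,\mathbb{C})$ and let $L_{H_1,H_2}$ be the operator $L^*$ restricted to the domain $$\mathcal{D}(L_{H_1,H_2}):=\{f\in\mathcal{D}(L^* )\mid H_2f_2(0)=H_1f_1(0)\}.$$ Then $L_{H_1,H_2}$ is self-adjoint in $L^2(\mathbb{R}_+,\mathbb{C}^{2n})$ if and only if the matrices $H_1,H_2$ are invertible and $B_1=H^*B_2H$, where $H:=H_2^{-1}H_1$.
   Context: Let $n\ge 1$, $\mathbb{R}_+=[0,\infty)$. Let $B=\begin{pmatrix}B_1&0\\0&-B_2\end{pmatrix}$ with $B_1,B_2\in \mathrm{M}(n,\mathbb{C})$ self-adjoint and positive definite, and let $Q:\mathbb{R}_+\to \mathrm{M}(2n,\mathbb{C})$ be a continuous function with self-adjoint values. Consider the formally self-adjoint operator $L:=B\frac1i\frac{d}{dx}+Q(x)$ acting on $H^1_{\rm comp}((0,\infty),\mathbb{C}^{2n})$ (the $H^1$-functions with compact support in $(0,\infty)$), viewed as an operator in $L^2(\mathbb{R}_+,\mathbb{C}^{2n})$; $L^*$ denotes its adjoint in $L^2(\mathbb{R}_+,\mathbb{C}^{2n})$. One has $\mathcal{D}(L^* )\subset H^1_{\rm loc}(\mathbb{R}_+,\mathbb{C}^{2n})$, so $f(0)$ makes sense for $f\in\mathcal{D}(L^* )$. For a vector $v\in\mathbb{C}^{2n}$, $v_1,v_2\in\mathbb{C}^n$ denote its first, respectively last, $n$ components; $f_1(0),f_2(0)$ are these components of $f(0)$. *)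

theory Defs
  imports "HOL-Analysis.Analysis"
begin

section \<open>Matrices over the complex numbers\<close>

definition cinner :: "complex^'m \<Rightarrow> complex^'m \<Rightarrow> complex" where
  "cinner u v = (\<Sum>i\<in>UNIV. u $ i * cnj (v $ i))"

definition conj_transpose :: "complex^'m^'k \<Rightarrow> complex^'k^'m" where
  "conj_transpose A = (\<chi> i j. cnj (A $ j $ i))"

definition self_adjoint_matrix :: "complex^'m^'m \<Rightarrow> bool" where
  "self_adjoint_matrix A \<longleftrightarrow> conj_transpose A = A"

text \<open>Taking the real part is harmless: the quadratic form of a self-adjoint matrix is real,
  and self-adjointness is always required separately.\<close>

definition positive_definite :: "complex^'m^'m \<Rightarrow> bool" where
  "positive_definite A \<longleftrightarrow> (\<forall>v. v \<noteq> 0 \<longrightarrow> 0 < Re (cinner (A *v v) v))"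

text \<open>The space of vectors with \<open>2n\<close> components is \<open>complex^('n + 'n)\<close>, where \<open>n = CARD('n) \<ge> 1\<close>;
  the indices \<open>Inl i\<close> are the first \<open>n\<close> ones and the indices \<open>Inr i\<close> the last \<open>n\<close> ones.\<close>

definition first_part :: "complex^('n + 'n) \<Rightarrow> complex^'n" where
  "first_part v = (\<chi> i. v $ Inl i)"

definition last_part :: "complex^('n + 'n) \<Rightarrow> complex^'n" where
  "last_part v = (\<chi> i. v $ Inr i)"

definition block_diag :: "complex^'n^'n \<Rightarrow> complex^'n^'n \<Rightarrow> complex^('n + 'n)^('n + 'n)" where
  "block_diag A D = (\<chi> i j. case (i, j) of
      (Inl k, Inl l) \<Rightarrow> A $ k $ l
    | (Inr k, Inr l) \<Rightarrow> D $ k $ l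
    | _ \<Rightarrow> 0)"


section \<open>Square-integrable functions on the half-line\<close>

text \<open>An element of the Hilbert space is represented by any of its representatives, a function whose
  values on the negative half-line are irrelevant. All notions below are invariant under changing
  functions on sets that are null for \<open>half_line\<close>.\<close>

abbreviation half_line :: "real measure" where
  "half_line \<equiv> lebesgue_on {0..}"

definition L2 :: "(real \<Rightarrow> complex^'m) set" where
  "L2 = {f. f \<in> borel_measurable half_line \<and> integrable half_line (\<lambda>x. (norm (f x))\<^sup>2)}"

definition L2_inner :: "(real \<Rightarrow> complex^'m) \<Rightarrow> (real \<Rightarrow> complex^'m) \<Rightarrow> complex" where
  "L2_inner f g = (LINT x|half_line. cinner (f x) (g x))"

definition L2_norm :: "(real \<Rightarrow> complex^'m) \<Rightarrow> real" where
  "L2_norm f = sqrt (LINT x|half_line. (norm (f x))\<^sup>2)"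


section \<open>Unbounded operators\<close>

text \<open>A (not everywhere defined) operator is given by its graph, consisting of all pairs of
  representatives \<open>(f, g)\<close> with \<open>f\<close> in the domain and \<open>g\<close> a representative of the image of \<open>f\<close>.\<close>

type_synonym 'm l2_op = "((real \<Rightarrow> complex^'m) \<times> (real \<Rightarrow> complex^'m)) set"

definition densely_defined :: "('m::finite) l2_op \<Rightarrow> bool" where
  "densely_defined T \<longleftrightarrow>
     (\<forall>f\<in>L2. \<forall>e>0. \<exists>u\<in>Domain T. L2_norm (\<lambda>x. f x - u x) < e)"

definition op_adjoint :: "('m::finite) l2_op \<Rightarrow> 'm l2_op" where
  "op_adjoint T = {(g, h). g \<in> L2 \<and> h \<in> L2 \<and>
     (\<forall>(u, v)\<in>T. L2_inner v g = L2_inner u h)}"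

definition self_adjoint_op :: "('m::finite) l2_op \<Rightarrow> bool" where
  "self_adjoint_op T \<longleftrightarrow> densely_defined T \<and> op_adjoint T = T"


section \<open>Sobolev spaces\<close>

definition test_function :: "(real \<Rightarrow> real) \<Rightarrow> bool" where
  "test_function \<phi> \<longleftrightarrow>
     (\<forall>k x. (deriv ^^ k) \<phi> differentiable (at x)) \<and>
     (\<exists>K. compact K \<and> K \<subseteq> {0<..} \<and> (\<forall>x. x \<notin> K \<longrightarrow> \<phi> x = 0))"

definition has_weak_derivative :: "(real \<Rightarrow> complex^'m) \<Rightarrow> (real \<Rightarrow> complex^'m) \<Rightarrow> bool" where
  "has_weak_derivative f f' \<longleftrightarrow>
     (\<forall>\<phi>. test_function \<phi> \<longrightarrow>
        (LINT x|half_line. deriv \<phi> x *\<^sub>R f x) = - (LINT x|half_line. \<phi> x *\<^sub>R f' x))"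

definition H1 :: "(real \<Rightarrow> complex^'m) set" where
  "H1 = {f \<in> L2. \<exists>f'\<in>L2. has_weak_derivative f f'}"

definition H1_comp :: "(real \<Rightarrow> complex^'m) set" where
  "H1_comp = {f \<in> H1. \<exists>K. compact K \<and> K \<subseteq> {0<..} \<and> (AE x in half_line. x \<notin> K \<longrightarrow> f x = 0)}"


section \<open>The first order system and its boundary conditions\<close>

definition minimal_op ::
    "complex^'m^'m \<Rightarrow> (real \<Rightarrow> complex^'m^'m) \<Rightarrow> 'm l2_op" where
  "minimal_op B Q = {(f, g). f \<in> H1_comp \<and> g \<in> L2 \<and>
     (\<exists>f'\<in>L2. has_weak_derivative f f' \<and>
        (AE x in half_line. g x = B *v ((1 / \<i>) *s f' x) + Q x *v f x))}"

text \<open>The value \<open>f(0)\<close> of a locally \<open>H\<^sup>1\<close> function is the value at \<open>0\<close> of its continuous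
  representative, which is unique on the closed half-line.\<close>

definition value_at_0 :: "(real \<Rightarrow> complex^'m) \<Rightarrow> complex^'m" where
  "value_at_0 f = (THE c. \<exists>h. continuous_on {0..} h \<and> (AE x in half_line. f x = h x) \<and> h 0 = c)"

definition boundary_op ::
    "complex^('n + 'n)^('n + 'n) \<Rightarrow> (real \<Rightarrow> complex^('n + 'n)^('n + 'n)) \<Rightarrow>
     complex^'n^'n \<Rightarrow> complex^'n^'n \<Rightarrow> ('n + 'n) l2_op" where
  "boundary_op B Q H\<^sub>1 H\<^sub>2 = {(f, g) \<in> op_adjoint (minimal_op B Q).
     H\<^sub>2 *v last_part (value_at_0 f) = H\<^sub>1 *v first_part (value_at_0 f)}"

end

theory Submission
  imports Defs
begin

text \<open>The adjoint of the minimal operator consists of the locally absolutely continuous square-integrable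
  functions with square-integrable image; this is the lemma of du Bois-Reymond. For two such
  functions \<open>f\<close> and \<open>g\<close> the function \<open>\<langle>B f, g\<rangle>\<close> is integrable with integrable derivative, hence tends
  to \<open>0\<close> at infinity, no matter how fast \<open>Q\<close> grows. So Green's formula only has a boundary term
  at \<open>0\<close>, and a boundary condition \<open>f(0) \<in> V\<close> is self-adjoint if and only if \<open>V\<close> is its own
  orthogonal complement for the indefinite form \<open>\<langle>B c, d\<rangle> = \<langle>B\<^sub>1 c\<^sub>1, d\<^sub>1\<rangle> - \<langle>B\<^sub>2 c\<^sub>2, d\<^sub>2\<rangle>\<close>. Such a \<open>V\<close>
  meets neither of the two definite coordinate subspaces, and this makes \<open>H\<^sub>1\<close> and \<open>H\<^sub>2\<close> injective.\<close>

subsection \<open>Test functions\<close>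

text \<open>Two facts turn the question about operators into one about \<open>V\<close>. Every
  vector is the boundary value of some function in the maximal domain, so Green's formula identifies
  the adjoint of the restriction to \<open>V\<close> with the restriction to the orthogonal
  complement of \<open>V\<close>. Functions with boundary value 0 are dense, which settles dense
  definedness for every \<open>V\<close> containing 0. The weight of the proof lies in regularity.
  An element of the adjoint of the minimal operator is known only through integrals against smooth
  functions supported away from 0, so bump functions have to be built with enough control to recover
  its values almost everywhere, and its continuous representative must extend to the end point 0.
  Its derivative is merely locally integrable, because \<open>Q\<close> may be unbounded at
  infinity. Hence absolute continuity is expressed by indefinite integrals, and \<open>Q\<close>
  enters only through local bounds and self-adjointness.\<close>

definition smooth :: "(real \<Rightarrow> real) \<Rightarrow> bool" where
  "smooth f \<longleftrightarrow> (\<forall>k x. (deriv ^^ k) f differentiable (at x))"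

text \<open>All iterated derivatives stay in \<open>F\<close>, so smoothness is a greatest fixed
  point. Each closure property below then only needs a family of functions stable under one
  differentiation, and no formula for higher derivatives.\<close>

lemma smooth_coinduct:
  assumes "f \<in> F" and F: "\<And>g. g \<in> F \<Longrightarrow> (\<forall>x. g differentiable (at x)) \<and> deriv g \<in> F"
  shows "smooth f"
proof -
  have "(deriv ^^ k) f \<in> F" for k
    by (induction k) (use assms in auto)
  with F show ?thesis by (auto simp: smooth_def)
qed

lemma smooth_differentiable: "smooth f \<Longrightarrow> f differentiable (at x)"
  unfolding smooth_def by (metis funpow_0)

lemma smooth_has_deriv: "smooth f \<Longrightarrow> (f has_real_derivative deriv f x) (at x)"
  using smooth_differentiable by (simp add: DERIV_deriv_iff_real_differentiable)

lemma smooth_deriv: "smooth f \<Longrightarrow> smooth (deriv f)"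
  unfolding smooth_def by (metis funpow_Suc_right o_apply)

lemma smooth_continuous_on: "smooth f \<Longrightarrow> continuous_on S f"
  by (meson DERIV_isCont continuous_at_imp_continuous_on smooth_has_deriv)

lemma smoothI:
  assumes "\<And>x. (f has_real_derivative f' x) (at x)" "smooth f'"
  shows "smooth f"
proof (rule smooth_coinduct[where F="insert f (Collect smooth)"])
  have "deriv f = f'" using assms by (auto intro: DERIV_imp_deriv)
  with assms show "(\<forall>x. g differentiable (at x)) \<and> deriv g \<in> insert f (Collect smooth)" if "g \<in> insert f (Collect smooth)" for g
    using that smooth_has_deriv real_differentiable_def by (auto intro: smooth_deriv)
qed auto

lemma smooth_linear_combination:
  assumes "smooth f" "smooth g"
  shows "smooth (\<lambda>x. a * f x + b * g x)"
proof (rule smooth_coinduct[where F="{\<lambda>x. a * f x + b * g x | f g. smooth f \<and> smooth g}"])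
  fix h assume "h \<in> {\<lambda>x. a * f x + b * g x | f g. smooth f \<and> smooth g}"
  then obtain f g where h: "h = (\<lambda>x. a * f x + b * g x)" and fg: "smooth f" "smooth g" by auto
  have d: "(h has_real_derivative a * deriv f x + b * deriv g x) (at x)" for x
    unfolding h by (auto intro!: derivative_eq_intros smooth_has_deriv fg)
  then have "deriv h = (\<lambda>x. a * deriv f x + b * deriv g x)" by (auto intro: DERIV_imp_deriv)
  with d fg show "(\<forall>x. h differentiable (at x)) \<and> deriv h \<in> {\<lambda>x. a * f x + b * g x | f g. smooth f \<and> smooth g}"
    by (auto simp: real_differentiable_def intro!: smooth_deriv)
qed (use assms in auto)

text \<open>Unlike the set of products, the set of sums of products is closed under \<open>deriv\<close>, as
  \<open>smooth_coinduct\<close> demands.\<close>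

inductive_set product_sums :: "(real \<Rightarrow> real) set" where
  prod: "smooth f \<Longrightarrow> smooth g \<Longrightarrow> (\<lambda>x. f x * g x) \<in> product_sums"
| add: "u \<in> product_sums \<Longrightarrow> v \<in> product_sums \<Longrightarrow> (\<lambda>x. u x + v x) \<in> product_sums"

lemma smooth_mult:
  assumes "smooth f" "smooth g"
  shows "smooth (\<lambda>x. f x * g x)"
proof (rule smooth_coinduct[where F=product_sums])
  fix h :: "real \<Rightarrow> real" assume "h \<in> product_sums"
  then have "\<exists>h'\<in>product_sums. \<forall>x. (h has_real_derivative h' x) (at x)"
  proof induction
    case (prod f g)
    then show ?case
      by (intro bexI[of _ "\<lambda>x. deriv f x * g x + deriv g x * f x"] allI DERIV_mult smooth_has_deriv
          product_sums.intros smooth_deriv)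
  next
    case (add u v)
    then obtain u' v' where "u' \<in> product_sums" "v' \<in> product_sums"
      "\<And>x. (u has_real_derivative u' x) (at x)" "\<And>x. (v has_real_derivative v' x) (at x)" by blast
    then show ?case
      by (intro bexI[of _ "\<lambda>x. u' x + v' x"] allI DERIV_add product_sums.intros) auto
  qed
  then obtain h' where h': "h' \<in> product_sums" "\<And>x. (h has_real_derivative h' x) (at x)" by blast
  moreover from this have "deriv h = h'" by (auto intro: DERIV_imp_deriv)
  ultimately show "(\<forall>x. h differentiable (at x)) \<and> deriv h \<in> product_sums"
    by (auto simp: real_differentiable_def)
qed (use assms product_sums.prod in auto)

lemma smooth_affine:
  assumes "smooth f"
  shows "smooth (\<lambda>x. f (a * x + b))"
\<comment> \<open>The constant \<open>c\<close> in the family absorbs the factors \<open>a\<close>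
  that the chain rule produces.\<close>
proof (rule smooth_coinduct[where F="{\<lambda>x. c * f (a * x + b) | f c. smooth f}"])
  show "(\<lambda>x. f (a * x + b)) \<in> {\<lambda>x. c * f (a * x + b) | f c. smooth f}"
    using assms by (auto intro!: exI[of _ f] exI[of _ 1])
  fix h assume "h \<in> {\<lambda>x. c * f (a * x + b) | f c. smooth f}"
  then obtain f c where h: "h = (\<lambda>x. c * f (a * x + b))" and f: "smooth f" by auto
  have "((\<lambda>x. f (a * x + b)) has_real_derivative deriv f (a * x + b) * a) (at x)" for x
    by (rule DERIV_chain2[OF smooth_has_deriv[OF f]]) (auto intro!: derivative_eq_intros)
  then have d: "(h has_real_derivative (c * a) * deriv f (a * x + b)) (at x)" for x
    unfolding h by (auto intro!: derivative_eq_intros)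
  then have "deriv h = (\<lambda>x. (c * a) * deriv f (a * x + b))" by (auto intro: DERIV_imp_deriv)
  with d f show "(\<forall>x. h differentiable (at x)) \<and> deriv h \<in> {\<lambda>x. c * f (a * x + b) | f c. smooth f}"
    using smooth_deriv[OF f] by (auto simp only: real_differentiable_def)
qed

section \<open>Flat functions and bump functions\<close>

definition flat_exp :: "real poly \<Rightarrow> real \<Rightarrow> real" where
  "flat_exp p x = (if x > 0 then poly p (1 / x) * exp (- (1 / x)) else 0)"

lemma poly_mult_exp_tendsto_0: "((\<lambda>t. poly p t * exp (- t)) \<longlongrightarrow> (0::real)) at_top"
proof -
  have "((\<lambda>t. \<Sum>i\<le>degree p. coeff p i * (t ^ i / exp t)) \<longlongrightarrow> (\<Sum>i\<le>degree p. coeff p i * 0)) at_top"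
    by (intro tendsto_intros tendsto_power_div_exp_0)
  then show ?thesis
    by (simp add: poly_altdef sum_distrib_right exp_minus divide_inverse mult.assoc)
qed

text \<open>For \<open>p = 1\<close> this is the classical exp(-1/x). The polynomial in t = 1/x
  makes the family stable under differentiation: dt/dx = -t^2 accounts for \<open>monom 1 2\<close>,
  and differentiating p(t) exp(-t) in t gives -(p - p')(t) exp(-t). Only the point 0 needs a
  limit.\<close>

lemma flat_exp_has_deriv:
  "(flat_exp p has_real_derivative flat_exp (monom 1 2 * (p - pderiv p)) x) (at x)"
proof -
  consider "x > 0" | "x < 0" | "x = 0" by linarith
  then show ?thesis
  proof cases
    case 1
    have "((\<lambda>x. poly p (1 / x) * exp (- (1 / x))) has_real_derivative flat_exp (monom 1 2 * (p - pderiv p)) x) (at x)"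
    proof -
      have i: "((\<lambda>x. 1 / x) has_real_derivative - (1 / x)\<^sup>2) (at x)"
        using 1 by (auto intro!: derivative_eq_intros simp: power2_eq_square)
      have "((\<lambda>x. poly p (1 / x) * exp (- (1 / x))) has_real_derivative
          poly (pderiv p) (1 / x) * (- (1 / x)\<^sup>2) * exp (- (1 / x)) + exp (- (1 / x)) * (- (- (1 / x)\<^sup>2)) * poly p (1 / x)) (at x)"
        by (intro DERIV_mult DERIV_chain2[OF poly_DERIV] DERIV_fun_exp DERIV_minus i)
      moreover have "flat_exp (monom 1 2 * (p - pderiv p)) x = (1 / x)\<^sup>2 * (poly p (1 / x) - poly (pderiv p) (1 / x)) * exp (- (1 / x))"
        unfolding flat_exp_def poly_mult poly_diff poly_monom using 1 by simp
      moreover have "d * (- t\<^sup>2) * e + e * (- (- t\<^sup>2)) * q = t\<^sup>2 * (q - d) * e" for d t e q :: real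
        by algebra
      ultimately show ?thesis by (simp only:)
    qed
    moreover have "\<forall>\<^sub>F y in nhds x. flat_exp p y = poly p (1 / y) * exp (- (1 / y))"
      using eventually_nhds_in_open[of "{0<..}" x] 1 by (auto elim!: eventually_mono simp: flat_exp_def)
    ultimately show ?thesis by (simp only: DERIV_cong_ev[OF refl _ refl])
  next
    case 2
    have "\<forall>\<^sub>F y in nhds x. flat_exp p y = 0"
      using eventually_nhds_in_open[of "{..<0}" x] 2 by (auto elim!: eventually_mono simp: flat_exp_def)
    then have "(flat_exp p has_real_derivative 0) (at x)"
      by (subst DERIV_cong_ev[OF refl _ refl]) auto
    with 2 show ?thesis by (simp add: flat_exp_def)
  next
    case 3
    have "((\<lambda>h. flat_exp p h / h) \<longlongrightarrow> 0) (at_right 0)"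
    proof -
      \<comment> \<open>The difference quotient at 0 is t p(t) exp(-t) with t = 1/h, and
        \<open>pCons 0 p\<close> is the polynomial t p(t).\<close>
      have "((\<lambda>h. poly (pCons 0 p) (inverse h) * exp (- inverse h)) \<longlongrightarrow> 0) (at_right (0::real))"
        by (rule filterlim_compose[OF poly_mult_exp_tendsto_0 filterlim_inverse_at_top_right])
      moreover have "\<forall>\<^sub>F h in at_right 0. poly (pCons 0 p) (inverse h) * exp (- inverse h) = flat_exp p h / h"
        by (auto simp: eventually_at_right_field flat_exp_def field_simps intro!: exI[of _ 1])
      ultimately show ?thesis by (rule Lim_transform_eventually)
    qed
    moreover have "((\<lambda>h. flat_exp p h / h) \<longlongrightarrow> 0) (at_left 0)"
      by (rule Lim_transform_eventually[of "\<lambda>_. 0"])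
        (auto simp: eventually_at_left_field flat_exp_def intro!: exI[of _ "-1"])
    ultimately have "((\<lambda>h. flat_exp p h / h) \<longlongrightarrow> 0) (at 0)"
      by (simp add: filterlim_at_split)
    then have "(flat_exp p has_real_derivative 0) (at 0)"
      by (simp add: DERIV_def flat_exp_def)
    with 3 show ?thesis by (simp add: flat_exp_def)
  qed
qed

lemma smooth_flat_exp: "smooth (flat_exp p)"
proof (rule smooth_coinduct[where F="range flat_exp"])
  fix g assume "g \<in> range flat_exp"
  then obtain p where g: "g = flat_exp p" by auto
  then have "deriv g = flat_exp (monom 1 2 * (p - pderiv p))"
    using flat_exp_has_deriv by (auto intro: DERIV_imp_deriv)
  then show "(\<forall>x. g differentiable (at x)) \<and> deriv g \<in> range flat_exp"
    using flat_exp_has_deriv[of p] g by (auto simp: real_differentiable_def)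
qed auto

text \<open>Stretching the argument by \<open>Suc n\<close> makes both factors tend to 1 inside the
  interval, since exp(-1/((n+1) y)) does for y > 0. So these functions approximate the indicator of
  the open interval while keeping their support fixed. With \<open>Suc n\<close> the stretching
  factor is positive already for n = 0.\<close>

definition bump :: "real \<Rightarrow> real \<Rightarrow> nat \<Rightarrow> real \<Rightarrow> real" where
  "bump a b n x = flat_exp 1 (real (Suc n) * (x - a)) * flat_exp 1 (real (Suc n) * (b - x))"

lemma smooth_bump: "smooth (bump a b n)"
proof -
  have "smooth (\<lambda>x. flat_exp 1 (real (Suc n) * x + - real (Suc n) * a) *
                    flat_exp 1 (- real (Suc n) * x + real (Suc n) * b))"
    by (intro smooth_mult smooth_affine smooth_flat_exp)
  then show ?thesis
    by (simp add: bump_def[abs_def] algebra_simps del: of_nat_Suc)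
qed

lemma bump_bounds: "0 \<le> bump a b n x" "bump a b n x \<le> 1"
  by (auto simp: bump_def flat_exp_def mult_le_one)

lemma bump_pos: "a < x \<Longrightarrow> x < b \<Longrightarrow> 0 < bump a b n x"
  by (simp add: bump_def flat_exp_def)

lemma bump_eq_0: "x \<notin> {a<..<b} \<Longrightarrow> bump a b n x = 0"
  by (auto simp: bump_def flat_exp_def zero_less_mult_iff)

lemma bump_tendsto_indicator: "(\<lambda>n. bump a b n x) \<longlonglongrightarrow> indicator {a<..<b} x"
proof (cases "x \<in> {a<..<b}")
  case True
  have *: "(\<lambda>n. flat_exp 1 (real (Suc n) * y)) \<longlonglongrightarrow> 1" if "y > 0" for y
  proof -
    have "(\<lambda>n. exp (- ((1 / y) * (1 / real (Suc n))))) \<longlonglongrightarrow> exp (- ((1 / y) * 0))"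
      by (intro tendsto_intros LIMSEQ_Suc lim_1_over_n)
    with that show ?thesis by (simp add: flat_exp_def mult.commute)
  qed
  have "(\<lambda>n. bump a b n x) \<longlonglongrightarrow> 1 * 1"
    unfolding bump_def using True by (intro tendsto_mult *) auto
  with True show ?thesis by simp
qed (auto simp: bump_eq_0)

section \<open>Supports, derivatives and primitives of test functions\<close>

lemma test_function_iff:
  "test_function \<phi> \<longleftrightarrow> smooth \<phi> \<and> (\<exists>a b. 0 < a \<and> a < b \<and> (\<forall>x. x \<notin> {a<..<b} \<longrightarrow> \<phi> x = 0))"
proof safe
  assume t: "test_function \<phi>"
  then show "smooth \<phi>" by (auto simp: test_function_def smooth_def)
  from t obtain K where K: "compact K" "K \<subseteq> {0<..}" "\<And>x. x \<notin> K \<Longrightarrow> \<phi> x = 0"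
    by (auto simp: test_function_def)
  show "\<exists>a b. 0 < a \<and> a < b \<and> (\<forall>x. x \<notin> {a<..<b} \<longrightarrow> \<phi> x = 0)"
  proof (cases "K = {}")
    case True
    with K(3) show ?thesis by (intro exI[of _ 1] exI[of _ 2]) auto
  next
    case False
    with K(1) obtain s t where st: "s \<in> K" "t \<in> K" "\<And>x. x \<in> K \<Longrightarrow> s \<le> x \<and> x \<le> t"
      using compact_attains_inf compact_attains_sup by metis
    then have "s > 0" using K by auto
    \<comment> \<open>Halving the minimum and adding 1 to the maximum puts \<open>K\<close> inside
      an open interval that still stays away from 0.\<close>
    moreover have "\<forall>x. x \<notin> {s/2<..<t+1} \<longrightarrow> x \<notin> K" using st \<open>s > 0\<close> by fastforce
    moreover have "s / 2 < t + 1" using st(3)[OF st(1)] \<open>s > 0\<close> by simp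
    ultimately show ?thesis using K(3) by (intro exI[of _ "s/2"] exI[of _ "t+1"]) auto
  qed
next
  fix a b :: real assume "smooth \<phi>" "0 < a" "a < b" "\<forall>x. x \<notin> {a<..<b} \<longrightarrow> \<phi> x = 0"
  then show "test_function \<phi>"
    unfolding test_function_def smooth_def
    by (intro conjI exI[of _ "{a..b}"]) auto
qed

lemma test_function_bump: "0 < a \<Longrightarrow> a < b \<Longrightarrow> test_function (bump a b n)"
  unfolding test_function_iff using smooth_bump bump_eq_0 by blast

lemma deriv_eq_0_outside:
  fixes \<phi> :: "real \<Rightarrow> real"
  assumes "smooth \<phi>" "\<forall>x. x \<notin> {a<..<b} \<longrightarrow> \<phi> x = 0" "x \<notin> {a..b}"
  shows "deriv \<phi> x = 0"
proof -
  have "\<forall>\<^sub>F y in nhds x. \<phi> y = 0"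
    by (rule eventually_mono[OF eventually_nhds_in_open[of "- {a..b}" x]])
      (use assms(2,3) in \<open>auto intro: closed_Compl simp: open_Compl\<close>)
  then have "(\<phi> has_real_derivative 0) (at x)"
    using DERIV_cong_ev[of x x \<phi> "\<lambda>_. 0" 0 0] by simp
  then show ?thesis by (rule DERIV_imp_deriv)
qed

lemma test_function_deriv:
  assumes "test_function \<phi>"
  shows "test_function (deriv \<phi>)"
proof -
  from assms obtain a b where ab: "smooth \<phi>" "0 < a" "a < b" "\<forall>x. x \<notin> {a<..<b} \<longrightarrow> \<phi> x = 0"
    by (auto simp: test_function_iff)
  \<comment> \<open>The interval is enlarged because the local argument for a vanishing derivative
    does not cover the end points \<open>a\<close> and \<open>b\<close>.\<close>
  have "deriv \<phi> x = 0" if "x \<notin> {a/2<..<b+1}" for x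
    using deriv_eq_0_outside[OF ab(1,4), of x] that ab by auto
  with ab show ?thesis
    unfolding test_function_iff by (intro conjI exI[of _ "a/2"] exI[of _ "b+1"] smooth_deriv) auto
qed

text \<open>The primitive starting at the left end of the support is constant to the right of it,
  and that constant is the total integral. Mean zero is therefore what makes the primitive compactly
  supported.\<close>

lemma test_function_primitive:
  assumes "test_function \<psi>" "(LINT x|half_line. \<psi> x) = 0"
  obtains \<phi> where "test_function \<phi>" "deriv \<phi> = \<psi>"
proof -
  from assms obtain a b where ab: "smooth \<psi>" "0 < a" "a < b" "\<And>x. x \<notin> {a<..<b} \<Longrightarrow> \<psi> x = 0"
    by (auto simp: test_function_iff)
  have cont: "continuous_on S \<psi>" for S by (rule smooth_continuous_on[OF ab(1)])
  have integral_outside: "integral {c..d} \<psi> = 0" if "{c..d} \<inter> {a<..<b} = {}" for c d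
  proof -
    have "\<psi> x = 0" if "x \<in> {c..d}" for x
      using that \<open>{c..d} \<inter> {a<..<b} = {}\<close> ab(4) by blast
    then show ?thesis by (subst integral_cong[of "{c..d}" \<psi> "\<lambda>_. 0"]) auto
  qed
  have intS: "\<psi> integrable_on {c..d}" for c d
    by (intro integrable_continuous_real cont)
  \<comment> \<open>For \<open>x < a\<close> the interval is empty and the integral is 0 by default,
    which is the correct value of the primitive there.\<close>
  define \<phi> where "\<phi> x = integral {a..x} \<psi>" for x
  have zero: "\<phi> x = 0" if "x \<notin> {a<..<b}" for x
  proof (cases "x \<le> a")
    case True
    then show ?thesis by (cases "x = a") (auto simp: \<phi>_def)
  next
    case False
    with that have "x \<ge> b" by auto
    have 1: "integral {b..x} \<psi> = 0"
      using ab by (intro integral_outside) auto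
    have "\<phi> x = integral {a..b} \<psi>"
      using Henstock_Kurzweil_Integration.integral_combine[of a b x \<psi>] ab \<open>x \<ge> b\<close> intS 1 by (simp add: \<phi>_def)
    also have "\<dots> = (LINT x|lebesgue_on {a..b}. \<psi> x)"
      by (intro lebesgue_integral_eq_integral[symmetric] continuous_imp_integrable_real cont) auto
    also have "\<dots> = (LINT x|half_line. (if x \<in> {a..b} then \<psi> x else 0))"
      using ab by (intro integral_restrict[symmetric]) auto
    also have "\<dots> = (LINT x|half_line. \<psi> x)"
      using ab by (intro Bochner_Integration.integral_cong) auto
    finally show ?thesis using assms by simp
  qed
  have D: "(\<phi> has_real_derivative \<psi> x) (at x)" for x
  proof -
    \<comment> \<open>Moving the base point to the left changes nothing, as \<open>\<psi>\<close>
      vanishes there, and makes \<open>x\<close> an interior point of the interval of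
      differentiation.\<close>
    define A where "A = min a (x - 1)"
    have "((\<lambda>y. integral {A..y} \<psi>) has_real_derivative \<psi> x) (at x within {A..x+1})"
      by (rule integral_has_real_derivative[OF cont]) (auto simp: A_def)
    then have "((\<lambda>y. integral {A..y} \<psi>) has_real_derivative \<psi> x) (at x)"
      by (subst (asm) at_within_interior) (auto simp: A_def)
    moreover have "integral {A..y} \<psi> = \<phi> y" for y
    proof (cases "y \<ge> a")
      case True
      have "integral {A..a} \<psi> = 0" using ab by (intro integral_outside) auto
      with True show ?thesis
        using Henstock_Kurzweil_Integration.integral_combine[of A a y \<psi>] intS by (simp add: \<phi>_def A_def)
    next
      case False
      have "integral {A..y} \<psi> = 0" using ab False by (intro integral_outside) auto
      with False zero[of y] show ?thesis by auto
    qed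
    ultimately show ?thesis by simp
  qed
  show thesis
  proof
    have "smooth \<phi>" using D ab(1) by (rule smoothI)
    with ab zero show "test_function \<phi>" unfolding test_function_iff by blast
    show "deriv \<phi> = \<psi>" using D by (auto intro: DERIV_imp_deriv)
  qed
qed

section \<open>Restricting and cutting off integrals\<close>

lemma integrable_lebesgue_on_subset:
  fixes f :: "real \<Rightarrow> 'a::{banach, second_countable_topology}"
  assumes "integrable (lebesgue_on S) f" "T \<subseteq> S" "S \<in> sets lebesgue" "T \<in> sets lebesgue"
  shows "integrable (lebesgue_on T) f"
proof -
  have "set_integrable lebesgue S f"
    using assms by (simp add: set_integrable_def integrable_restrict_space)
  then have "set_integrable lebesgue T f"
    by (rule set_integrable_subset) (use assms in auto)
  then show ?thesis using assms by (simp add: set_integrable_def integrable_restrict_space)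
qed

lemma finite_measure_interval: "finite_measure (lebesgue_on {a..b::real})"
  using finite_measure_lebesgue_on[OF lmeasurable_cbox[of a b]] by simp

lemma integral_half_line_cutoff:
  fixes f :: "real \<Rightarrow> 'a::euclidean_space"
  assumes "\<And>x. x > T \<Longrightarrow> f x = 0"
  shows "(LINT x|half_line. f x) = (LINT x|lebesgue_on {0..T}. f x)"
proof -
  have "(LINT x|half_line. f x) = (LINT x|half_line. (if x \<in> {0..T} then f x else 0))"
    using assms by (intro Bochner_Integration.integral_cong) auto
  also have "\<dots> = (LINT x|lebesgue_on {0..T}. f x)"
    by (intro integral_restrict) auto
  finally show ?thesis .
qed

lemma integrable_half_line_cutoff:
  fixes f :: "real \<Rightarrow> 'a::euclidean_space"
  assumes "\<And>x. x > T \<Longrightarrow> f x = 0" "integrable (lebesgue_on {0..T}) f"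
  shows "integrable half_line f"
proof -
  have "(\<lambda>x. if x \<in> {0..T} then f x else 0) = (\<lambda>x. if x \<in> {0..} then f x else 0)"
    using assms(1) by fastforce
  with assms(2) show ?thesis
    using Lebesgue_Measure.integrable_restrict_UNIV[of "{0..T}" f]
      Lebesgue_Measure.integrable_restrict_UNIV[of "{0..}" f] by simp
qed

lemma AE_half_line_imp_AE_interval:
  assumes "AE x in half_line. P x" "S \<subseteq> {0..}" "S \<in> sets lebesgue"
  shows "AE x in lebesgue_on S. P x"
proof -
  have "AE x in lebesgue. x \<in> {0..} \<longrightarrow> P x"
    using assms(1) by (subst (asm) AE_restrict_space_iff) auto
  then have "AE x in lebesgue. x \<in> S \<longrightarrow> P x"
    by eventually_elim (use assms in auto)
  then show ?thesis using assms by (subst AE_restrict_space_iff) auto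
qed

subsection \<open>Absolutely continuous functions\<close>

text \<open>Local absolute continuity on the closed half-line, stated through the fundamental
  theorem of calculus. The density \<open>w\<close> plays the role of the derivative and is kept
  explicit, so that no pointwise differentiability has to be proved. Integrability of
  \<open>w\<close> down to 0 is what gives \<open>F\<close> a boundary value.\<close>

definition abs_cont :: "(real \<Rightarrow> 'a::euclidean_space) \<Rightarrow> (real \<Rightarrow> 'a) \<Rightarrow> bool" where
  "abs_cont F w \<longleftrightarrow> (\<forall>T\<ge>0. integrable (lebesgue_on {0..T}) w \<and>
     F T = F 0 + (LINT t|lebesgue_on {0..T}. w t))"

lemma abs_contD:
  assumes "abs_cont F w" "T \<ge> 0"
  shows "integrable (lebesgue_on {0..T}) w" "F T = F 0 + (LINT t|lebesgue_on {0..T}. w t)"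
  using assms unfolding abs_cont_def by blast+

lemma abs_cont_continuous_interval:
  assumes "abs_cont F w" "T \<ge> 0"
  shows "continuous_on {0..T} F"
proof -
  have "continuous_on {0..T} (\<lambda>x. F 0 + (LINT t|lebesgue_on {0..x}. w t))"
    by (intro continuous_intros indefinite_integral_continuous_real abs_contD(1)[OF assms])
  then show ?thesis
    by (rule continuous_on_eq) (simp add: abs_contD(2)[OF assms(1), symmetric])
qed

lemma abs_cont_continuous_on:
  assumes "abs_cont F w"
  shows "continuous_on {0..} F"
  unfolding continuous_on_eq_continuous_within
proof
  fix x :: real assume x: "x \<in> {0..}"
  have "continuous (at x within {0..x+1}) F"
    using abs_cont_continuous_interval[OF assms, of "x+1"] x by (auto simp: continuous_on_eq_continuous_within)
  moreover have "at x within {0..} = at x within {0..x+1}"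
    by (rule at_within_nhd[of x "{..<x+1}"]) auto
  ultimately show "continuous (at x within {0..}) F" by (simp add: continuous_within)
qed

lemma abs_cont_integral:
  assumes "\<And>T. T \<ge> 0 \<Longrightarrow> integrable (lebesgue_on {0..T}) w"
  shows "abs_cont (\<lambda>x. c + (LINT t|lebesgue_on {0..x}. w t)) w"
proof -
  have "(LINT t|lebesgue_on {0..0::real}. w t) = 0"
    by (intro integral_eq_zero_null_sets) auto
  then show ?thesis using assms by (simp add: abs_cont_def)
qed

lemma abs_cont_C1:
  fixes F :: "real \<Rightarrow> 'a::euclidean_space"
  assumes "\<And>x. (F has_vector_derivative w x) (at x)" "continuous_on UNIV w"
  shows "abs_cont F w"
  unfolding abs_cont_def
proof safe
  fix T :: real assume "T \<ge> 0"
  show i: "integrable (lebesgue_on {0..T}) w"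
    by (rule continuous_imp_integrable_real[OF continuous_on_subset[OF assms(2)]]) auto
  have "(w has_integral (F T - F 0)) {0..T}"
    by (rule fundamental_theorem_of_calculus[OF \<open>T \<ge> 0\<close>])
      (rule has_vector_derivative_at_within[OF assms(1)])
  then have "integral {0..T} w = F T - F 0" by (rule integral_unique)
  moreover have "(LINT t|lebesgue_on {0..T}. w t) = integral {0..T} w"
    by (rule lebesgue_integral_eq_integral[OF i]) auto
  ultimately have "(LINT t|lebesgue_on {0..T}. w t) = F T - F 0" by (rule trans[rotated])
  then show "F T = F 0 + (LINT t|lebesgue_on {0..T}. w t)" by (metis add.commute diff_add_cancel)
qed

text \<open>Derivatives exist only almost everywhere here, so the product rule is replaced by Fubini's
  theorem on the square, cut along its diagonal.\<close>

lemma integral_by_parts_primitives: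
  fixes p :: "'a::euclidean_space \<Rightarrow> 'b::euclidean_space \<Rightarrow> 'c::euclidean_space" and T :: real
  assumes p: "bounded_bilinear p"
    and w: "integrable (lebesgue_on {0..T}) w" and z: "integrable (lebesgue_on {0..T}) z"
  defines "W \<equiv> \<lambda>x. LINT t|lebesgue_on {0..x}. w t"
  defines "Z \<equiv> \<lambda>x. LINT t|lebesgue_on {0..x}. z t"
  shows "integrable (lebesgue_on {0..T}) (\<lambda>x. p (w x) (Z x))"
    and "integrable (lebesgue_on {0..T}) (\<lambda>x. p (W x) (z x))"
    and "(LINT x|lebesgue_on {0..T}. p (w x) (Z x)) + (LINT x|lebesgue_on {0..T}. p (W x) (z x)) = p (W T) (Z T)"
proof -
  interpret p: bounded_bilinear p by fact
  let ?M = "lebesgue_on {0..T}"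
  interpret M: finite_measure ?M by (rule finite_measure_interval)
  interpret M: pair_sigma_finite ?M ?M ..
  have [measurable]: "w \<in> borel_measurable ?M" "z \<in> borel_measurable ?M"
    using w z by auto
  define h where "h = (\<lambda>q. p (w (fst q)) (z (snd q)))"
  have cont: "continuous_on UNIV (\<lambda>x. p (fst x) (snd x))"
    by (intro p.continuous_on continuous_intros)
  have [measurable]: "h \<in> borel_measurable (?M \<Otimes>\<^sub>M ?M)"
    unfolding h_def by (rule borel_measurable_continuous_Pair[OF _ _ cont]) measurable
  obtain K where K: "\<And>a b. norm (p a b) \<le> norm a * norm b * K"
    using p.bounded by blast
  have int_h: "integrable (?M \<Otimes>\<^sub>M ?M) h"
  proof (rule Bochner_Integration.integrable_bound)
    have "integrable (?M \<Otimes>\<^sub>M ?M) (\<lambda>q. norm (w (fst q)) * norm (z (snd q)))"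
      by (rule M.Fubini_integrable) (use w z in auto)
    then show "integrable (?M \<Otimes>\<^sub>M ?M) (\<lambda>q. norm (w (fst q)) * norm (z (snd q)) * K)" by simp
    show "AE q in ?M \<Otimes>\<^sub>M ?M. norm (h q) \<le> norm (norm (w (fst q)) * norm (z (snd q)) * K)"
      unfolding h_def real_norm_def by (intro AE_I2 order_trans[OF K abs_ge_self])
  qed simp
  have id: "(\<lambda>x. x) \<in> borel_measurable ?M"
    by (intro measurable_restrict_space1 measurable_completion) simp
  have [measurable]: "(\<lambda>q. fst q) \<in> borel_measurable (?M \<Otimes>\<^sub>M ?M)" "(\<lambda>q. snd q) \<in> borel_measurable (?M \<Otimes>\<^sub>M ?M)"
    using measurable_compose[OF measurable_fst id] measurable_compose[OF measurable_snd id] by auto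
  \<comment> \<open>Over this triangle w(x) z(y) is integrated first in y, which yields
    \<open>p (w x) (Z x)\<close>. Over the complement it is integrated first in x, which yields
    \<open>p (W y) (z y)\<close>.\<close>
  define D where "D = {q \<in> space (?M \<Otimes>\<^sub>M ?M). snd q \<le> fst q}"
  have [measurable]: "D \<in> sets (?M \<Otimes>\<^sub>M ?M)"
    unfolding D_def by measurable
  define h1 where "h1 = (\<lambda>q. indicator D q *\<^sub>R h q)"
  define h2 where "h2 = (\<lambda>q. indicator (space (?M \<Otimes>\<^sub>M ?M) - D) q *\<^sub>R h q)"
  have h1: "integrable (?M \<Otimes>\<^sub>M ?M) h1" and h2: "integrable (?M \<Otimes>\<^sub>M ?M) h2"
    unfolding h1_def h2_def by (intro integrable_mult_indicator int_h; measurable)+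
  have part: "(LINT y|?M. (if y \<in> {0..x} then v y else 0)) = (LINT y|lebesgue_on {0..x}. v y)"
    if "x \<in> {0..T}" for x and v :: "real \<Rightarrow> 'd::euclidean_space"
    using that by (intro integral_restrict) auto
  have e1: "(LINT y|?M. h1 (x, y)) = p (w x) (Z x)" if "x \<in> {0..T}" for x
  proof -
    have "(LINT y|?M. h1 (x, y)) = (LINT y|?M. p (w x) (if y \<in> {0..x} then z y else 0))"
      using that by (intro Bochner_Integration.integral_cong)
        (auto simp: h1_def h_def D_def space_pair_measure p.zero_right)
    also have "\<dots> = p (w x) (LINT y|?M. (if y \<in> {0..x} then z y else 0))"
    proof (rule integral_bounded_linear[OF p.bounded_linear_right])
      have "integrable ?M (\<lambda>y. indicator {0..x} y *\<^sub>R z y)"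
        using that by (intro integrable_mult_indicator z) (auto simp: sets_restrict_space_iff)
      then show "integrable ?M (\<lambda>y. if y \<in> {0..x} then z y else 0)"
        by (simp add: indicator_scaleR_eq_if)
    qed
    finally show ?thesis using part[OF that, of z] by (simp add: Z_def)
  qed
  have e2: "(LINT x|?M. h2 (x, y)) = p (W y) (z y)" if "y \<in> {0..T}" for y
  proof -
    \<comment> \<open>The complement of the triangle requires x < y strictly, whereas
      \<open>W y\<close> integrates over the closed interval. The two differ only at the null point
      x = y.\<close>
    have "AE x in lebesgue. x \<noteq> y" by (intro AE_completion AE_lborel_singleton)
    then have ne: "AE x in ?M. x \<noteq> y"
      by (subst AE_restrict_space_iff) auto
    have i: "integrable ?M (\<lambda>x. if x \<in> {0..y} then w x else 0)"
    proof -
      have "integrable ?M (\<lambda>x. indicator {0..y} x *\<^sub>R w x)"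
        using that by (intro integrable_mult_indicator w) (auto simp: sets_restrict_space_iff)
      then show ?thesis by (simp add: indicator_scaleR_eq_if)
    qed
    have "(LINT x|?M. h2 (x, y)) = (LINT x|?M. p (if x \<in> {0..y} then w x else 0) (z y))"
    proof (rule integral_cong_AE)
      show "AE x in ?M. h2 (x, y) = p (if x \<in> {0..y} then w x else 0) (z y)"
        using ne AE_space by eventually_elim
          (use that in \<open>auto simp: h2_def h_def D_def space_pair_measure p.zero_left indicator_def\<close>)
      show "(\<lambda>x. h2 (x, y)) \<in> borel_measurable ?M"
        by (rule measurable_compose[OF measurable_Pair2' borel_measurable_integrable[OF h2]])
          (use that in simp)
      show "(\<lambda>x. p (if x \<in> {0..y} then w x else 0) (z y)) \<in> borel_measurable ?M"
        using integrable_bounded_linear[OF p.bounded_linear_left i] by auto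
    qed
    also have "\<dots> = p (LINT x|?M. (if x \<in> {0..y} then w x else 0)) (z y)"
      by (rule integral_bounded_linear[OF p.bounded_linear_left i])
    finally show ?thesis using part[OF that, of w] by (simp add: W_def)
  qed
  have "integrable ?M (\<lambda>x. LINT y|?M. h1 (x, y))" by (rule M.integrable_fst'[OF h1])
  then show "integrable ?M (\<lambda>x. p (w x) (Z x))"
    by (rule Bochner_Integration.integrable_cong[THEN iffD1, rotated 2]) (auto simp: e1)
  have "integrable ?M (\<lambda>y. LINT x|?M. h2 (x, y))"
    by (rule M.integrable_snd) (use h2 in simp)
  then show "integrable ?M (\<lambda>x. p (W x) (z x))"
    by (rule Bochner_Integration.integrable_cong[THEN iffD1, rotated 2]) (auto simp: e2)
  have "(LINT x|?M. p (w x) (Z x)) = (LINT x|?M. LINT y|?M. h1 (x, y))"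
    by (intro Bochner_Integration.integral_cong) (auto simp: e1)
  also have "\<dots> = (LINT q|(?M \<Otimes>\<^sub>M ?M). h1 q)" by (rule M.integral_fst'[OF h1])
  finally have 1: "(LINT x|?M. p (w x) (Z x)) = (LINT q|(?M \<Otimes>\<^sub>M ?M). h1 q)" .
  have "(LINT x|?M. p (W x) (z x)) = (LINT y|?M. LINT x|?M. h2 (x, y))"
    by (intro Bochner_Integration.integral_cong) (auto simp: e2)
  also have "\<dots> = (LINT q|(?M \<Otimes>\<^sub>M ?M). h2 q)"
    using M.integral_snd[of "\<lambda>x y. h2 (x, y)"] h2 by simp
  finally have 2: "(LINT x|?M. p (W x) (z x)) = (LINT q|(?M \<Otimes>\<^sub>M ?M). h2 q)" .
  have "(LINT x|?M. p (w x) (Z x)) + (LINT x|?M. p (W x) (z x)) = (LINT q|(?M \<Otimes>\<^sub>M ?M). h1 q + h2 q)"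
    unfolding 1 2 using h1 h2 by simp
  also have "\<dots> = (LINT q|(?M \<Otimes>\<^sub>M ?M). h q)"
    by (intro Bochner_Integration.integral_cong) (auto simp: h1_def h2_def indicator_def)
  also have "\<dots> = (LINT x|?M. LINT y|?M. h (x, y))"
    by (rule M.integral_fst'[OF int_h, symmetric])
  also have "\<dots> = (LINT x|?M. p (w x) (Z T))"
    unfolding h_def Z_def by (simp add: integral_bounded_linear[OF p.bounded_linear_right z])
  also have "\<dots> = p (W T) (Z T)"
    unfolding W_def by (rule integral_bounded_linear[OF p.bounded_linear_left w])
  finally show "(LINT x|?M. p (w x) (Z x)) + (LINT x|?M. p (W x) (z x)) = p (W T) (Z T)" .
qed

lemma integral_by_parts:
  fixes p :: "'a::euclidean_space \<Rightarrow> 'b::euclidean_space \<Rightarrow> 'c::euclidean_space"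
  assumes p: "bounded_bilinear p" and F: "abs_cont F w" and G: "abs_cont G z" and "T \<ge> 0"
  shows "integrable (lebesgue_on {0..T}) (\<lambda>x. p (w x) (G x) + p (F x) (z x))"
    and "(LINT x|lebesgue_on {0..T}. p (w x) (G x) + p (F x) (z x)) = p (F T) (G T) - p (F 0) (G 0)"
proof -
  interpret p: bounded_bilinear p by fact
  let ?M = "lebesgue_on {0..T}"
  define W where "W x = (LINT t|lebesgue_on {0..x}. w t)" for x
  define Z where "Z x = (LINT t|lebesgue_on {0..x}. z t)" for x
  have w: "integrable ?M w" and z: "integrable ?M z"
    and F': "\<And>x. x \<ge> 0 \<Longrightarrow> F x = F 0 + W x" and G': "\<And>x. x \<ge> 0 \<Longrightarrow> G x = G 0 + Z x"
    unfolding W_def Z_def using abs_contD F G \<open>T \<ge> 0\<close> by blast+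
  note parts = integral_by_parts_primitives[OF p w z, folded W_def Z_def]
  note lin = integrable_bounded_linear[OF p.bounded_linear_left w] integrable_bounded_linear[OF p.bounded_linear_right z]
  \<comment> \<open>Expanding F = F 0 + W and G = G 0 + Z leaves four terms. The two without a
    constant factor belong to the preceding lemma, and in the other two the constant comes out of
    the integral.\<close>
  define r where "r = (\<lambda>x. (p (w x) (G 0) + p (w x) (Z x)) + (p (F 0) (z x) + p (W x) (z x)))"
  have r: "p (w x) (G x) + p (F x) (z x) = r x" if "x \<in> {0..T}" for x
    using that F'[of x] G'[of x] by (simp add: r_def p.add_left p.add_right)
  have int_r: "integrable ?M r"
    unfolding r_def by (intro Bochner_Integration.integrable_add parts lin)
  then show "integrable ?M (\<lambda>x. p (w x) (G x) + p (F x) (z x))"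
    by (rule Bochner_Integration.integrable_cong[THEN iffD1, rotated 2]) (auto simp: r)
  have "(LINT x|?M. p (w x) (G x) + p (F x) (z x)) = (LINT x|?M. r x)"
    by (intro Bochner_Integration.integral_cong) (auto simp: r)
  also have "\<dots> = p (W T) (G 0) + p (F 0) (Z T) + p (W T) (Z T)"
  proof -
    have "(LINT x|?M. p (w x) (G 0)) = p (W T) (G 0)" "(LINT x|?M. p (F 0) (z x)) = p (F 0) (Z T)"
      unfolding W_def Z_def
      by (rule integral_bounded_linear[OF p.bounded_linear_left w] integral_bounded_linear[OF p.bounded_linear_right z])+
    then show ?thesis
      unfolding r_def parts(3)[symmetric] using parts(1,2) lin by simp
  qed
  also have "\<dots> = p (F T) (G T) - p (F 0) (G 0)"
    using F'[of T] G'[of T] \<open>T \<ge> 0\<close> by (simp add: p.add_left p.add_right)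
  finally show "(LINT x|?M. p (w x) (G x) + p (F x) (z x)) = p (F T) (G T) - p (F 0) (G 0)" .
qed

subsection \<open>The lemma of du Bois-Reymond\<close>

lemma integrable_continuous_bilinear:
  fixes p :: "'a::euclidean_space \<Rightarrow> 'b::euclidean_space \<Rightarrow> 'c::euclidean_space" and T :: real
  assumes p: "bounded_bilinear p" and a: "continuous_on {0..T} a"
    and g: "integrable (lebesgue_on {0..T}) g"
  shows "integrable (lebesgue_on {0..T}) (\<lambda>x. p (a x) (g x))"
proof -
  have "(\<lambda>x. p (a x) (g x)) absolutely_integrable_on {0..T}"
  proof (rule absolutely_integrable_bounded_measurable_product[of p])
    show "bilinear p" using p by (simp add: bilinear_conv_bounded_bilinear)
    show "a \<in> borel_measurable (lebesgue_on {0..T})"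
      by (intro continuous_imp_measurable_on_sets_lebesgue a) auto
    show "bounded (a ` {0..T})"
      by (intro compact_imp_bounded compact_continuous_image a) auto
    show "g absolutely_integrable_on {0..T}"
      using g by (simp add: integrable_restrict_space set_integrable_def)
  qed auto
  then show ?thesis by (simp add: integrable_restrict_space set_integrable_def)
qed

lemma integrable_test_scaleR:
  fixes g :: "real \<Rightarrow> 'a::euclidean_space"
  assumes "test_function \<psi>" and g: "\<And>T. T \<ge> 0 \<Longrightarrow> integrable (lebesgue_on {0..T}) g"
  shows "integrable half_line (\<lambda>x. \<psi> x *\<^sub>R g x)"
proof -
  from assms(1) obtain a b where ab: "smooth \<psi>" "0 < a" "a < b" "\<forall>x. x \<notin> {a<..<b} \<longrightarrow> \<psi> x = 0"
    by (auto simp: test_function_iff)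
  have "integrable (lebesgue_on {0..b}) (\<lambda>x. \<psi> x *\<^sub>R g x)"
    by (rule integrable_continuous_bilinear[OF bounded_bilinear_scaleR smooth_continuous_on[OF ab(1)] g])
      (use ab in simp)
  then show ?thesis
    by (rule integrable_half_line_cutoff[rotated]) (use ab in auto)
qed

text \<open>The sets over which the integral vanishes include the intervals and are closed under
  complements and countable disjoint unions, hence include the Borel sets. Null sets then give every
  Lebesgue set, and a function with vanishing integral over every measurable set is null.\<close>

lemma AE_zero_if_interval_integrals_zero:
  fixes k :: "real \<Rightarrow> 'a::euclidean_space"
  assumes int: "integrable (lebesgue_on {c..d}) k"
    and zero: "\<And>a b. c \<le> a \<Longrightarrow> a \<le> b \<Longrightarrow> b \<le> d \<Longrightarrow> (LINT x|lebesgue_on {a..b}. k x) = 0"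
  shows "AE x in lebesgue_on {c..d}. k x = 0"
proof -
  let ?M = "lebesgue_on {c..d}"
  interpret finite_measure ?M by (rule finite_measure_interval)
  have sets: "A \<inter> {c..d} \<in> sets ?M" if "A \<in> sets lebesgue" for A
    using that sets.Int[of A lebesgue "{c..d}"] by (simp add: sets_restrict_space_iff)
  have si: "set_integrable ?M A k" if "A \<in> sets ?M" for A
    unfolding set_integrable_def by (intro integrable_mult_indicator that int)
  have all: "(LINT x|?M. k x) = 0"
    by (cases "c \<le> d") (use zero in auto)
  have borel: "(LINT x:A \<inter> {c..d}|?M. k x) = 0" if "A \<in> sets borel" for A
    using that
  proof (induction rule: borel_set_induct)
    case empty
    then show ?case by (simp add: set_lebesgue_integral_def)
  next
    case (interval a b)
    have "(LINT x:{a..b} \<inter> {c..d}|?M. k x) = (LINT x|lebesgue_on {max a c..min b d}. k x)"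
      unfolding set_lebesgue_integral_def indicator_scaleR_eq_if
      by (subst integral_restrict) auto
    then show ?case
      by (cases "max a c \<le> min b d") (use zero[of "max a c" "min b d"] in auto)
  next
    case (compl A)
    have A: "A \<inter> {c..d} \<in> sets ?M" by (intro sets) (use compl in auto)
    have "(LINT x:-A \<inter> {c..d}|?M. k x) = (LINT x|?M. k x - indicator (A \<inter> {c..d}) x *\<^sub>R k x)"
      unfolding set_lebesgue_integral_def
      by (intro Bochner_Integration.integral_cong) (auto simp: indicator_def)
    also have "\<dots> = (LINT x|?M. k x) - (LINT x:A \<inter> {c..d}|?M. k x)"
      unfolding set_lebesgue_integral_def
      using int si[OF A] by (intro Bochner_Integration.integral_diff) (auto simp: set_integrable_def)
    finally show ?case using all compl by simp
  next
    case (union f)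
    have A: "f i \<inter> {c..d} \<in> sets ?M" for i by (intro sets) (use union in auto)
    have "(LINT x:(\<Union>i. f i \<inter> {c..d})|?M. k x) = (\<Sum>i. (LINT x:f i \<inter> {c..d}|?M. k x))"
      using union(1) A
      by (intro lebesgue_integral_countable_add si sets.countable_UN) (auto simp: disjoint_family_on_def)
    with union show ?case by simp
  qed
  have "(LINT x:A|?M. k x) = 0" if A: "A \<in> sets ?M" for A
  proof -
    from A have "A \<in> sets lebesgue" "A \<subseteq> {c..d}" by (auto simp: sets_restrict_space_iff)
    \<comment> \<open>A Lebesgue set is a Borel set \<open>S\<close> up to a part of a Borel null
      set \<open>N'\<close>, so its integral equals the one over \<open>S\<close>.\<close>
    then obtain S N N' where S: "A = S \<union> N" "N \<subseteq> N'" "N' \<in> null_sets lborel" "S \<in> sets lborel"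
      by (elim sets_completionE)
    have "AE x in lebesgue. x \<notin> N'"
      by (intro AE_completion AE_not_in S)
    then have ae: "AE x in ?M. x \<notin> N'"
      by (subst AE_restrict_space_iff) auto
    have "(LINT x:A|?M. k x) = (LINT x:S \<inter> {c..d}|?M. k x)"
      unfolding set_lebesgue_integral_def
    proof (rule integral_cong_AE)
      have *: "S \<inter> {c..d} \<in> sets ?M" by (intro sets) (use S in auto)
      show "(\<lambda>x. indicat_real A x *\<^sub>R k x) \<in> borel_measurable ?M"
        "(\<lambda>x. indicat_real (S \<inter> {c..d}) x *\<^sub>R k x) \<in> borel_measurable ?M"
        using si[OF A] si[OF *] by (auto simp: set_integrable_def)
      show "AE x in ?M. indicat_real A x *\<^sub>R k x = indicat_real (S \<inter> {c..d}) x *\<^sub>R k x"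
        using ae AE_space by eventually_elim (use S in \<open>auto simp: indicator_def\<close>)
    qed
    with borel[of S] S show ?thesis by simp
  qed
  then show ?thesis by (rule density_zero[OF int])
qed

text \<open>Subtracting the indefinite integral \<open>W\<close> of \<open>w\<close> leaves
  \<open>k\<close>, which is orthogonal to all derivatives of test functions, that is, to all test
  functions of mean zero. Correcting an arbitrary bump by a multiple of one fixed bump gives it mean
  zero, so \<open>k - c\<close> is orthogonal to all bumps for a suitable constant \<open>c\<close>,
  hence to indicators of intervals. Local integrability is assumed instead of membership in
  \<open>L2\<close>, since the candidate derivative in the application involves
  \<open>Q\<close>.\<close>

lemma weak_derivative_imp_abs_cont:
  fixes f w :: "real \<Rightarrow> 'a::euclidean_space"
  assumes f: "\<And>T. T \<ge> 0 \<Longrightarrow> integrable (lebesgue_on {0..T}) f"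
    and w: "\<And>T. T \<ge> 0 \<Longrightarrow> integrable (lebesgue_on {0..T}) w"
    and weak: "\<And>\<phi>. test_function \<phi> \<Longrightarrow>
      (LINT x|half_line. deriv \<phi> x *\<^sub>R f x) = - (LINT x|half_line. \<phi> x *\<^sub>R w x)"
  obtains F where "abs_cont F w" "AE x in half_line. f x = F x"
proof -
  define W where "W x = (LINT t|lebesgue_on {0..x}. w t)" for x
  have W: "abs_cont W w"
    using abs_cont_integral[OF w, of 0] by (simp add: W_def[abs_def])
  define k where "k x = f x - W x" for x
  have int_W: "integrable (lebesgue_on {0..T}) W" if "T \<ge> 0" for T
    by (rule continuous_imp_integrable_real[OF abs_cont_continuous_interval[OF W that]])
  have int_k: "integrable (lebesgue_on {0..T}) k" if "T \<ge> 0" for T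
    unfolding k_def by (intro Bochner_Integration.integrable_diff f int_W that)
  note smul = integrable_continuous_bilinear[OF bounded_bilinear_scaleR smooth_continuous_on]
  have test_k: "(LINT x|half_line. deriv \<phi> x *\<^sub>R k x) = 0" if "test_function \<phi>" for \<phi>
  proof -
    from that obtain a b where ab: "smooth \<phi>" "0 < a" "a < b" "\<forall>x. x \<notin> {a<..<b} \<longrightarrow> \<phi> x = 0"
      by (auto simp: test_function_iff)
    let ?M = "lebesgue_on {0..b}"
    have 0: "\<phi> x = 0" "deriv \<phi> x = 0" if "x > b" for x
      using that ab deriv_eq_0_outside[OF ab(1,4)] by auto
    have "abs_cont \<phi> (deriv \<phi>)"
      using smooth_has_deriv[OF ab(1)] smooth_continuous_on[OF smooth_deriv[OF ab(1)]]
      by (intro abs_cont_C1) (auto simp: has_real_derivative_iff_has_vector_derivative)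
    from integral_by_parts(2)[OF bounded_bilinear_scaleR this W, of b] ab
    have "(LINT x|?M. deriv \<phi> x *\<^sub>R W x + \<phi> x *\<^sub>R w x) = 0" by simp
    moreover have "(LINT x|?M. deriv \<phi> x *\<^sub>R f x) = - (LINT x|?M. \<phi> x *\<^sub>R w x)"
      using weak[OF that] 0 by (simp add: integral_half_line_cutoff[of b])
    ultimately have "(LINT x|?M. deriv \<phi> x *\<^sub>R k x) = 0"
      using ab smul[OF smooth_deriv int_W] smul[OF smooth_deriv f] smul[OF ab(1) w]
      by (simp add: k_def scaleR_diff_right) (metis add.commute minus_unique)
    with 0 show ?thesis by (simp add: integral_half_line_cutoff[of b])
  qed
  define \<psi>0 where "\<psi>0 = bump 1 2 0"
  have \<psi>0: "test_function \<psi>0" unfolding \<psi>0_def by (rule test_function_bump) auto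
  have intb: "integrable half_line (bump a b n)" if "0 < a" "a < b" for a b n
    by (rule integrable_half_line_cutoff[of b], simp add: bump_eq_0)
      (intro continuous_imp_integrable_real smooth_continuous_on smooth_bump)
  define I0 where "I0 = (LINT x|half_line. \<psi>0 x)"
  have "I0 \<noteq> 0"
  proof
    assume "I0 = 0"
    then have "(LINT x|lebesgue_on {0..2}. \<psi>0 x) = 0"
      unfolding I0_def by (subst (asm) integral_half_line_cutoff[of 2]) (auto simp: \<psi>0_def bump_eq_0)
    then have "\<forall>x\<in>{0..2}. \<psi>0 x = 0"
      by (subst (asm) integralL_eq_0_iff) (auto simp: \<psi>0_def bump_bounds smooth_continuous_on smooth_bump)
    with bump_pos[of 1 "3/2" 2 0] show False by (auto simp: \<psi>0_def)
  qed
  \<comment> \<open>If \<open>k\<close> is constant, the constant must be its mean with weight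
    \<open>\<psi>0\<close>.\<close>
  define c where "c = (LINT x|half_line. \<psi>0 x *\<^sub>R k x) /\<^sub>R I0"
  have int_kc: "integrable (lebesgue_on {0..T}) (\<lambda>x. k x - c)" if "T \<ge> 0" for T
    using finite_measure.integrable_const[OF finite_measure_interval, of 0 T c] int_k[OF that]
    by (intro Bochner_Integration.integrable_diff)
  have bump_kc: "(LINT x|half_line. bump a b n x *\<^sub>R (k x - c)) = 0" if "0 < a" "a < b" for a b n
  proof -
    define J where "J = (LINT x|half_line. bump a b n x)"
    \<comment> \<open>The coefficient is chosen to make the integral J - (J / I0) I0 vanish, so that
      \<open>\<psi>\<close> is the derivative of a test function.\<close>
    define \<psi> where "\<psi> x = 1 * bump a b n x + (- J / I0) * \<psi>0 x" for x
    have t\<psi>: "test_function \<psi>"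
    proof -
      have "smooth \<psi>"
        unfolding \<psi>_def \<psi>0_def by (intro smooth_linear_combination smooth_bump)
      moreover have "\<psi> x = 0" if "x \<notin> {min a 1<..<max b 2}" for x
      proof -
        have "x \<notin> {a<..<b}" "x \<notin> {1<..<2}" using that by auto
        then show ?thesis by (simp add: \<psi>_def \<psi>0_def bump_eq_0 del: greaterThanLessThan_iff)
      qed
      ultimately show ?thesis
        using that unfolding test_function_iff
        by (intro conjI exI[of _ "min a 1"] exI[of _ "max b 2"]) auto
    qed
    have "(LINT x|half_line. \<psi> x) = J - J / I0 * I0"
      unfolding \<psi>_def J_def I0_def using intb[OF that, of n] intb[of 1 2 0] by (simp add: \<psi>0_def)
    then obtain \<phi> where "test_function \<phi>" "deriv \<phi> = \<psi>"
      using test_function_primitive[OF t\<psi>] \<open>I0 \<noteq> 0\<close> by auto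
    with test_k have "(LINT x|half_line. \<psi> x *\<^sub>R k x) = 0" by blast
    moreover have "(LINT x|half_line. \<psi> x *\<^sub>R k x) =
        (LINT x|half_line. bump a b n x *\<^sub>R k x) + (LINT x|half_line. (- J / I0) *\<^sub>R (\<psi>0 x *\<^sub>R k x))"
      unfolding \<psi>_def scaleR_add_left mult_1 scaleR_scaleR[symmetric]
      by (intro Bochner_Integration.integral_add integrable_scaleR_right integrable_test_scaleR int_k
          test_function_bump \<psi>0 that)
    moreover have "(LINT x|half_line. (- J / I0) *\<^sub>R (\<psi>0 x *\<^sub>R k x)) = - (J *\<^sub>R c)"
      unfolding integral_scaleR_right by (simp add: c_def divide_inverse)
    ultimately have "(LINT x|half_line. bump a b n x *\<^sub>R k x) = J *\<^sub>R c" by simp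
    then show ?thesis
      using intb[OF that, of n] integrable_test_scaleR[OF test_function_bump[OF that] int_k, of n]
      by (simp add: scaleR_diff_right J_def)
  qed
  have zero: "(LINT x|lebesgue_on {a..b}. k x - c) = 0" if "0 < a" "a \<le> b" for a b
  proof (cases "a = b")
    case True
    then show ?thesis by (intro integral_eq_zero_null_sets) auto
  next
    case False
    with that have ab: "a < b" by simp
    let ?M = "lebesgue_on {0..b}"
    have "(\<lambda>n. LINT x|?M. bump a b n x *\<^sub>R (k x - c)) \<longlonglongrightarrow> (LINT x|?M. indicator {a<..<b} x *\<^sub>R (k x - c))"
    proof (rule integral_dominated_convergence)
      show "integrable ?M (\<lambda>x. norm (k x - c))" using int_kc[of b] ab that by auto
      show "(\<lambda>x. indicator {a<..<b} x *\<^sub>R (k x - c)) \<in> borel_measurable ?M"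
        using that by (intro borel_measurable_integrable integrable_mult_indicator int_kc)
          (auto simp: sets_restrict_space_iff)
      show "(\<lambda>x. bump a b n x *\<^sub>R (k x - c)) \<in> borel_measurable ?M" for n
        using that by (intro borel_measurable_integrable smul int_kc smooth_bump) auto
      show "AE x in ?M. (\<lambda>n. bump a b n x *\<^sub>R (k x - c)) \<longlonglongrightarrow> indicator {a<..<b} x *\<^sub>R (k x - c)"
        by (intro AE_I2 tendsto_intros bump_tendsto_indicator)
      show "AE x in ?M. norm (bump a b n x *\<^sub>R (k x - c)) \<le> norm (k x - c)" for n
        using bump_bounds[of a b n] by (intro AE_I2) (auto intro!: mult_left_le_one_le)
    qed
    moreover have "(LINT x|?M. bump a b n x *\<^sub>R (k x - c)) = 0" for n
      using bump_kc[OF that(1) ab, of n] by (subst (asm) integral_half_line_cutoff[of b]) (auto simp: bump_eq_0)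
    ultimately have "(LINT x|?M. indicator {a<..<b} x *\<^sub>R (k x - c)) = 0"
      by (simp add: LIMSEQ_const_iff)
    also have "(LINT x|?M. indicator {a<..<b} x *\<^sub>R (k x - c)) = (LINT x|lebesgue_on {a<..<b}. k x - c)"
    proof -
      have "(LINT x|?M. indicator {a<..<b} x *\<^sub>R (k x - c)) = (LINT x|?M. (if x \<in> {a<..<b} then k x - c else 0))"
        by (intro Bochner_Integration.integral_cong) (auto simp: indicator_def)
      also have "\<dots> = (LINT x|lebesgue_on {a<..<b}. k x - c)"
        by (rule integral_restrict) (use that in auto)
      finally show ?thesis .
    qed
    also have "\<dots> = (LINT x|lebesgue_on {a..b}. k x - c)"
    proof -
      have i: "integrable (lebesgue_on {a..b}) (\<lambda>x. k x - c)"
        using that by (intro integrable_lebesgue_on_subset[OF int_kc[of b]]) auto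
      have "integrable (lebesgue_on {a<..<b}) (\<lambda>x. k x - c)"
        by (intro integrable_lebesgue_on_subset[OF i]) auto
      with i show ?thesis
        by (simp add: lebesgue_integral_eq_integral integral_open_interval[of a b, unfolded box_real])
    qed
    finally show ?thesis .
  qed
  \<comment> \<open>Bumps live away from 0, so equality is obtained on intervals exhausting the open
    half-line. The remaining point 0 is null.\<close>
  have "AE x in lebesgue. \<forall>n. x \<in> {1 / real (Suc n)..real (Suc n)} \<longrightarrow> k x - c = 0"
  proof (subst AE_all_countable, rule allI)
    fix n
    have "AE x in lebesgue_on {1 / real (Suc n)..real (Suc n)}. k x - c = 0"
    proof (rule AE_zero_if_interval_integrals_zero)
      show "integrable (lebesgue_on {1 / real (Suc n)..real (Suc n)}) (\<lambda>x. k x - c)"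
        by (intro integrable_lebesgue_on_subset[OF int_kc[of "real (Suc n)"]])
          (auto intro: order_trans[rotated])
      fix a b assume "1 / real (Suc n) \<le> a" "a \<le> b"
      moreover have "0 < 1 / real (Suc n)" by simp
      ultimately show "(LINT x|lebesgue_on {a..b}. k x - c) = 0" by (intro zero) linarith+
    qed
    then show "AE x in lebesgue. x \<in> {1 / real (Suc n)..real (Suc n)} \<longrightarrow> k x - c = 0"
      by (subst (asm) AE_restrict_space_iff) auto
  qed
  moreover have "AE x in lebesgue. x \<noteq> (0::real)" by (intro AE_completion AE_lborel_singleton)
  ultimately have "AE x in lebesgue. x \<in> {0..} \<longrightarrow> f x = c + W x"
  proof eventually_elim
    case (elim x)
    show ?case
    proof
      assume "x \<in> {0..}"
      with elim have "x > 0" by auto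
      obtain m :: nat where m: "1 / x \<le> m" using real_arch_simple by blast
      obtain l :: nat where l: "x \<le> l" using real_arch_simple by blast
      have "1 / x \<le> real (Suc (m + l))" "x \<le> real (Suc (m + l))" using m l by auto
      with \<open>x > 0\<close> have "x \<in> {1 / real (Suc (m + l))..real (Suc (m + l))}"
        by (auto simp: field_simps)
      with elim have "k x - c = 0" by blast
      then show "f x = c + W x" by (simp add: k_def algebra_simps)
    qed
  qed
  then have "AE x in half_line. f x = c + W x"
    by (subst AE_restrict_space_iff) auto
  then show thesis
    using that abs_cont_integral[OF w, of c] by (simp add: W_def[abs_def])
qed

subsection \<open>The sesquilinear form\<close>

text \<open>Conjugate linearity is still linearity over the reals, which opens the real bilinear
  calculus, in particular integration by parts, to the sesquilinear form.\<close>

lemma bounded_bilinear_cinner: "bounded_bilinear (cinner :: complex^'m \<Rightarrow> complex^'m \<Rightarrow> complex)"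
  unfolding bilinear_conv_bounded_bilinear[symmetric] bilinear_def
  by (auto intro!: linearI simp: cinner_def algebra_simps sum.distrib scaleR_sum_right)

lemma bounded_bilinear_matrix_vector:
  "bounded_bilinear ((*v) :: complex^'m^'k \<Rightarrow> complex^'m \<Rightarrow> complex^'k)"
  unfolding bilinear_conv_bounded_bilinear[symmetric] bilinear_def
  by (auto intro!: linearI simp: matrix_vector_mult_def vec_eq_iff algebra_simps sum.distrib scaleR_sum_right)

interpretation cinner: bounded_bilinear "cinner :: complex^'m \<Rightarrow> complex^'m \<Rightarrow> complex"
  by (rule bounded_bilinear_cinner)

interpretation matrix_vector: bounded_bilinear "(*v) :: complex^'m^'k \<Rightarrow> complex^'m \<Rightarrow> complex^'k"
  by (rule bounded_bilinear_matrix_vector)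

lemma bounded_linear_scale: "bounded_linear (\<lambda>v::complex^'m. c *s v)"
  unfolding linear_conv_bounded_linear[symmetric]
  by (auto intro!: linearI simp: vec_eq_iff algebra_simps)

lemma cinner_scale_left [simp]: "cinner (c *s u) v = c * cinner u v"
  by (simp add: cinner_def sum_distrib_left algebra_simps)

lemma cinner_scale_right [simp]: "cinner u (c *s v) = cnj c * cinner u v"
  by (simp add: cinner_def sum_distrib_left algebra_simps)

lemma cinner_commute: "cinner v u = cnj (cinner u v)"
  by (simp add: cinner_def algebra_simps)

lemma cinner_eq_0_imp:
  assumes "\<And>u. cinner u v = 0"
  shows "v = 0"
proof -
  have "v $ i = 0" for i
  proof -
    have "cinner (axis i 1) v = (\<Sum>j\<in>UNIV. if j = i then cnj (v $ i) else 0)"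
      unfolding cinner_def axis_def by (intro sum.cong) auto
    with assms[of "axis i 1"] show ?thesis by simp
  qed
  then show ?thesis by (simp add: vec_eq_iff)
qed

lemma cinner_matrix_left: "cinner (A *v u) v = cinner u (conj_transpose A *v v)"
proof -
  have "cinner (A *v u) v = (\<Sum>i\<in>UNIV. \<Sum>j\<in>UNIV. A $ i $ j * u $ j * cnj (v $ i))"
    by (simp add: cinner_def matrix_vector_mult_def sum_distrib_right)
  also have "\<dots> = (\<Sum>j\<in>UNIV. \<Sum>i\<in>UNIV. A $ i $ j * u $ j * cnj (v $ i))"
    by (rule sum.swap)
  also have "\<dots> = cinner u (conj_transpose A *v v)"
    by (simp add: cinner_def matrix_vector_mult_def conj_transpose_def sum_distrib_left algebra_simps)
  finally show ?thesis .
qed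

lemma cinner_self_adjoint: "self_adjoint_matrix A \<Longrightarrow> cinner (A *v u) v = cinner u (A *v v)"
  by (simp add: cinner_matrix_left self_adjoint_matrix_def)

lemma matrix_vector_scale: "A *v (c *s v) = c *s (A *v (v :: complex^'m))"
  by (simp add: vec_eq_iff matrix_vector_mult_def sum_distrib_left algebra_simps)

subsection \<open>Square-integrable functions\<close>

text \<open>The product of two norms is at most the sum of their squares. One bound serves both the
  inner product and the form \<open>cinner (B *v u) v\<close>.\<close>

lemma L2_integrable_bilinear:
  fixes p :: "complex^'m \<Rightarrow> complex^'k \<Rightarrow> 'c::euclidean_space"
  assumes p: "bounded_bilinear p" and f: "f \<in> L2" and g: "g \<in> L2"
  shows "integrable half_line (\<lambda>x. p (f x) (g x))"
proof -
  interpret p: bounded_bilinear p by fact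
  obtain K where K: "0 \<le> K" "\<And>a b. norm (p a b) \<le> norm a * norm b * K"
    using p.nonneg_bounded by blast
  show ?thesis
  proof (rule Bochner_Integration.integrable_bound)
    show "integrable half_line (\<lambda>x. ((norm (f x))\<^sup>2 + (norm (g x))\<^sup>2) * K)"
      using f g unfolding L2_def by simp
    have "bilinear p" using p by (simp add: bilinear_conv_bounded_bilinear)
    then show "(\<lambda>x. p (f x) (g x)) \<in> borel_measurable half_line"
      by (rule borel_measurable_bilinear) (use f g in \<open>simp_all add: L2_def\<close>)
    show "AE x in half_line. norm (p (f x) (g x)) \<le> norm (((norm (f x))\<^sup>2 + (norm (g x))\<^sup>2) * K)"
    proof (intro AE_I2)
      fix x
      have "2 * (norm (f x) * norm (g x)) \<le> (norm (f x))\<^sup>2 + (norm (g x))\<^sup>2"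
        using sum_squares_bound[of "norm (f x)" "norm (g x)"] by simp
      then have "norm (f x) * norm (g x) \<le> (norm (f x))\<^sup>2 + (norm (g x))\<^sup>2"
        using mult_nonneg_nonneg[OF norm_ge_zero[of "f x"] norm_ge_zero[of "g x"]] by linarith
      then have "norm (p (f x) (g x)) \<le> ((norm (f x))\<^sup>2 + (norm (g x))\<^sup>2) * K"
        by (intro order_trans[OF K(2)] mult_right_mono K(1))
      then show "norm (p (f x) (g x)) \<le> norm (((norm (f x))\<^sup>2 + (norm (g x))\<^sup>2) * K)"
        unfolding real_norm_def by (rule order_trans[OF _ abs_ge_self])
    qed
  qed
qed

lemma L2_locally_integrable:
  assumes "f \<in> L2"
  shows "integrable (lebesgue_on {0..T}) f"
proof (rule Bochner_Integration.integrable_bound)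
  let ?M = "lebesgue_on {0..T}"
  have "integrable ?M (\<lambda>x. (norm (f x))\<^sup>2)"
    by (rule integrable_lebesgue_on_subset[of "{0..}"]) (use assms in \<open>auto simp: L2_def\<close>)
  then show "integrable ?M (\<lambda>x. 1 + (norm (f x))\<^sup>2)"
    by (rule Bochner_Integration.integrable_add[OF finite_measure.integrable_const[OF finite_measure_interval]])
  have "f \<in> borel_measurable half_line" using assms by (simp add: L2_def)
  then show "f \<in> borel_measurable ?M"
    by (rule measurable_restrict_mono) auto
  show "AE x in ?M. norm (f x) \<le> norm (1 + (norm (f x))\<^sup>2)"
  proof (intro AE_I2)
    fix x
    have "2 * norm (f x) \<le> 1 + (norm (f x))\<^sup>2"
      using sum_squares_bound[of 1 "norm (f x)"] by simp
    then have "norm (f x) \<le> 1 + (norm (f x))\<^sup>2"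
      using norm_ge_zero[of "f x"] by linarith
    then show "norm (f x) \<le> norm (1 + (norm (f x))\<^sup>2)"
      unfolding real_norm_def by (rule order_trans[OF _ abs_ge_self])
  qed
qed

lemma L2_continuous_cutoff:
  assumes "continuous_on {0..} f" "\<And>x. x > T \<Longrightarrow> f x = 0"
  shows "f \<in> L2"
proof -
  have "continuous_on {0..T} f" by (rule continuous_on_subset[OF assms(1)]) auto
  then have "integrable (lebesgue_on {0..T}) (\<lambda>x. (norm (f x))\<^sup>2)"
    by (intro continuous_imp_integrable_real continuous_intros)
  then have "integrable half_line (\<lambda>x. (norm (f x))\<^sup>2)"
    by (rule integrable_half_line_cutoff[rotated]) (simp add: assms(2))
  moreover have "f \<in> borel_measurable half_line"
    by (intro continuous_imp_measurable_on_sets_lebesgue assms) auto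
  ultimately show ?thesis by (simp add: L2_def)
qed

section \<open>Behaviour at infinity and boundary values at 0\<close>

lemma integral_interval_tendsto_half_line:
  fixes q :: "real \<Rightarrow> 'a::euclidean_space"
  assumes "integrable half_line q"
  shows "((\<lambda>T. LINT x|lebesgue_on {0..T}. q x) \<longlongrightarrow> (LINT x|half_line. q x)) at_top"
proof (rule tendsto_at_topI_sequentially)
  fix X :: "nat \<Rightarrow> real" assume X: "filterlim X at_top sequentially"
  have "(\<lambda>n. LINT x|half_line. indicator {0..X n} x *\<^sub>R q x) \<longlonglongrightarrow> (LINT x|half_line. q x)"
  proof (rule integral_dominated_convergence)
    show "integrable half_line (\<lambda>x. norm (q x))" using assms by simp
    show "q \<in> borel_measurable half_line" using assms by auto
    show "(\<lambda>x. indicator {0..X n} x *\<^sub>R q x) \<in> borel_measurable half_line" for n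
      using assms by (intro borel_measurable_integrable integrable_mult_indicator) (auto simp: sets_restrict_space_iff)
    show "AE x in half_line. (\<lambda>n. indicator {0..X n} x *\<^sub>R q x) \<longlonglongrightarrow> q x"
    proof (intro AE_I2)
      fix x :: real assume x: "x \<in> space half_line"
      have "\<forall>\<^sub>F n in sequentially. x \<le> X n" using X by (auto simp: filterlim_at_top)
      then have "\<forall>\<^sub>F n in sequentially. q x = indicator {0..X n} x *\<^sub>R q x"
        by eventually_elim (use x in auto)
      then show "(\<lambda>n. indicator {0..X n} x *\<^sub>R q x) \<longlonglongrightarrow> q x"
        by (rule Lim_transform_eventually[OF tendsto_const])
    qed
    show "AE x in half_line. norm (indicator {0..X n} x *\<^sub>R q x) \<le> norm (q x)" for n
      by (intro AE_I2) (auto simp: indicator_def)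
  qed
  moreover have "(LINT x|half_line. indicator {0..X n} x *\<^sub>R q x) = (LINT x|lebesgue_on {0..X n}. q x)" for n
  proof -
    have "(LINT x|half_line. indicator {0..X n} x *\<^sub>R q x) = (LINT x|half_line. (if x \<in> {0..X n} then q x else 0))"
      by (intro Bochner_Integration.integral_cong) (auto simp: indicator_def)
    also have "\<dots> = (LINT x|lebesgue_on {0..X n}. q x)"
      by (rule integral_restrict) auto
    finally show ?thesis .
  qed
  ultimately show "(\<lambda>n. LINT x|lebesgue_on {0..X n}. q x) \<longlonglongrightarrow> (LINT x|half_line. q x)" by simp
qed

text \<open>Otherwise the norm of \<open>p\<close> exceeds half the norm of \<open>L\<close> from
  some point on, and ever longer intervals make its integral exceed every bound.\<close>

lemma integrable_half_line_limit_zero: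
  fixes p :: "real \<Rightarrow> complex"
  assumes int: "integrable half_line p" and lim: "(p \<longlongrightarrow> L) at_top"
  shows "L = 0"
proof (rule ccontr)
  assume "L \<noteq> 0"
  then have "\<forall>\<^sub>F x in at_top. dist (p x) L < norm L / 2"
    using lim by (intro tendstoD) auto
  then obtain X0 where X0: "\<And>x. x \<ge> X0 \<Longrightarrow> dist (p x) L < norm L / 2"
    by (auto simp: eventually_at_top_linorder)
  define X where "X = max 0 X0"
  have X: "norm L / 2 \<le> norm (p x)" if "x \<ge> X" for x
  proof -
    have "norm L \<le> norm (p x) + norm (L - p x)" using norm_triangle_ineq[of "p x" "L - p x"] by simp
    with X0[of x] that show ?thesis by (simp add: X_def dist_norm norm_minus_commute)
  qed
  have bound: "real n * (norm L / 2) \<le> (LINT x|half_line. norm (p x))" for n :: nat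
  proof -
    have m: "{X..X + real n} \<in> sets half_line" by (auto simp: sets_restrict_space_iff X_def)
    have "real n * (norm L / 2) = (LINT x|half_line. indicator {X..X + real n} x *\<^sub>R (norm L / 2))"
      using m by (simp add: measure_restrict_space X_def)
    also have "\<dots> \<le> (LINT x|half_line. norm (p x))"
    proof (rule integral_mono)
      show "integrable half_line (\<lambda>x. indicator {X..X + real n} x *\<^sub>R (norm L / 2))"
        using m by (intro integrable_scaleR_left integrable_real_indicator)
          (auto simp: emeasure_restrict_space X_def)
      show "integrable half_line (\<lambda>x. norm (p x))" using int by simp
      show "indicator {X..X + real n} x *\<^sub>R (norm L / 2) \<le> norm (p x)" for x
        using X[of x] by (auto simp: indicator_def)
    qed
    finally show ?thesis .
  qed
  obtain n :: nat where "(LINT x|half_line. norm (p x)) / (norm L / 2) < n"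
    using reals_Archimedean2 by blast
  then have "(LINT x|half_line. norm (p x)) < real n * (norm L / 2)"
    using \<open>L \<noteq> 0\<close> by (simp only: pos_divide_less_eq zero_less_norm_iff half_gt_zero_iff simp_thms)
  with bound[of n] show False by linarith
qed

text \<open>By continuity a nonzero value at 0 persists on some interval to the right, which is not
  a null set. This gives the uniqueness of boundary values and their vanishing on the minimal
  domain.\<close>

lemma continuous_AE_zero_imp_zero_at_0:
  fixes h :: "real \<Rightarrow> 'a::real_normed_vector"
  assumes cont: "continuous_on {0..} h" and ae: "AE x in half_line. x < a \<longrightarrow> h x = 0" and "a > 0"
  shows "h 0 = 0"
proof (rule ccontr)
  assume "h 0 \<noteq> 0"
  then have "0 < norm (h 0)" by simp
  moreover have "(0::real) \<in> {0..}" by simp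
  ultimately obtain d where d: "d > 0" "\<forall>x\<in>{0..}. dist x 0 < d \<longrightarrow> dist (h x) (h 0) < norm (h 0)"
    using cont unfolding continuous_on_iff by meson
  have nz: "h x \<noteq> 0" if "0 \<le> x" "x < d" for x
    using d(2)[rule_format, of x] that by auto
  define e where "e = min a d"
  have "AE x in half_line. x \<notin> {0..<e}"
    using ae AE_space by eventually_elim (use nz in \<open>auto simp: e_def\<close>)
  moreover have "{0..<e} \<in> sets half_line" by (auto simp: sets_restrict_space_iff)
  ultimately have "{0..<e} \<in> null_sets half_line"
    by (simp add: AE_iff_null_sets)
  then have "emeasure half_line {0..<e} = 0" by (rule null_setsD1)
  moreover have "emeasure half_line {0..<e} = emeasure lebesgue {0..<e}"
    by (rule emeasure_restrict_space) (auto simp: e_def)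
  moreover have "0 < e" using d(1) \<open>a > 0\<close> by (simp add: e_def)
  ultimately show False by simp
qed

lemma value_at_0_eq:
  assumes "continuous_on {0..} F" "AE x in half_line. f x = F x"
  shows "value_at_0 f = F 0"
  unfolding value_at_0_def
proof (rule the_equality)
  show "\<exists>h. continuous_on {0..} h \<and> (AE x in half_line. f x = h x) \<and> h 0 = F 0"
    using assms by blast
  fix c assume "\<exists>h. continuous_on {0..} h \<and> (AE x in half_line. f x = h x) \<and> h 0 = c"
  then obtain h where h: "continuous_on {0..} h" "AE x in half_line. f x = h x" "h 0 = c" by blast
  have "AE x in half_line. x < 1 \<longrightarrow> h x - F x = 0"
    using h(2) assms(2) by eventually_elim auto
  then have "h 0 - F 0 = 0"
    by (intro continuous_AE_zero_imp_zero_at_0[of "\<lambda>x. h x - F x" 1] continuous_intros h assms) auto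
  with h show "c = F 0" by simp
qed

subsection \<open>The maximal operator\<close>

text \<open>\<open>F\<close> is the continuous representative of \<open>f\<close>, and \<open>h\<close> represents the image of \<open>f\<close>.\<close>

definition maximal_graph ::
  "complex^'m^'m \<Rightarrow> (real \<Rightarrow> complex^'m^'m) \<Rightarrow> (real \<Rightarrow> complex^'m) \<Rightarrow> (real \<Rightarrow> complex^'m) \<Rightarrow>
   (real \<Rightarrow> complex^'m) \<Rightarrow> (real \<Rightarrow> complex^'m) \<Rightarrow> bool" where
  "maximal_graph B Q f h F w \<longleftrightarrow> f \<in> L2 \<and> h \<in> L2 \<and> abs_cont F w \<and>
     (AE x in half_line. f x = F x) \<and>
     (AE x in half_line. h x = B *v ((1 / \<i>) *s w x) + Q x *v f x)"

text \<open>Green's formula has no contribution at infinity: \<open>cinner (B *v F x) (G x)\<close> is integrable and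
  has a limit at infinity, which therefore vanishes.\<close>

lemma green_formula:
  assumes B: "self_adjoint_matrix B" and Q: "\<And>x. x \<ge> 0 \<Longrightarrow> self_adjoint_matrix (Q x)"
    and f: "maximal_graph B Q f h F w" and g: "maximal_graph B Q g k G z"
  shows "L2_inner h g - L2_inner f k = \<i> * cinner (B *v F 0) (G 0)"
proof -
  define b where "b u v = cinner (B *v u) v" for u v
  have b: "bounded_bilinear b"
    unfolding b_def[abs_def]
    by (rule cinner.comp1[OF matrix_vector.bounded_linear_right])
  note defs = f[unfolded maximal_graph_def] g[unfolded maximal_graph_def]
  have F: "abs_cont F w" and G: "abs_cont G z" using defs by auto
  define q where "q x = cinner (h x) (g x) - cinner (f x) (k x)" for x
  have i1: "integrable half_line (\<lambda>x. cinner (h x) (g x))" and i2: "integrable half_line (\<lambda>x. cinner (f x) (k x))"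
    using defs by (auto intro: L2_integrable_bilinear[OF bounded_bilinear_cinner])
  then have q: "integrable half_line q" by (simp add: q_def[abs_def])
  \<comment> \<open>Self-adjointness of \<open>Q x\<close> cancels the potential. Since the
    conjugate of 1/i is -1/i, the difference in \<open>q\<close> becomes a sum, and self-adjointness
    of \<open>B\<close> lets it be read as the product rule for
    \<open>b (F x) (G x)\<close>.\<close>
  have "AE x in half_line. b (w x) (G x) + b (F x) (z x) = \<i> * q x"
  proof -
    have "AE x in half_line. f x = F x" "AE x in half_line. g x = G x"
      "AE x in half_line. h x = B *v ((1 / \<i>) *s w x) + Q x *v f x"
      "AE x in half_line. k x = B *v ((1 / \<i>) *s z x) + Q x *v g x"
      using defs by auto
    then show ?thesis using AE_space
    proof eventually_elim
      case (elim x)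
      then have Qx: "cinner (Q x *v f x) (g x) = cinner (f x) (Q x *v g x)"
        by (intro cinner_self_adjoint Q) auto
      have "q x = (1 / \<i>) * cinner (B *v w x) (g x) - cnj (1 / \<i>) * cinner (f x) (B *v z x)"
        unfolding q_def elim(3,4) matrix_vector_scale cinner.add_left cinner.add_right Qx
          cinner_scale_left cinner_scale_right by simp
      also have "\<dots> = (1 / \<i>) * (b (w x) (G x) + b (F x) (z x))"
        unfolding b_def cinner_self_adjoint[OF B, of "F x"] using elim(1,2) by (simp add: algebra_simps)
      finally show ?case by simp
    qed
  qed
  then have ae: "AE x in lebesgue_on {0..T}. b (w x) (G x) + b (F x) (z x) = \<i> * q x" for T
    by (rule AE_half_line_imp_AE_interval) auto
  have eq: "b (F T) (G T) = b (F 0) (G 0) + \<i> * (LINT x|lebesgue_on {0..T}. q x)" if "T \<ge> 0" for T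
  proof -
    have "integrable (lebesgue_on {0..T}) q"
      by (rule integrable_lebesgue_on_subset[OF q]) auto
    then have "(LINT x|lebesgue_on {0..T}. b (w x) (G x) + b (F x) (z x)) = (LINT x|lebesgue_on {0..T}. \<i> * q x)"
      by (intro integral_cong_AE ae borel_measurable_integrable integrable_mult_right
          integral_by_parts(1)[OF b F G that])
    with integral_by_parts(2)[OF b F G that] show ?thesis by simp
  qed
  have "((\<lambda>T. b (F 0) (G 0) + \<i> * (LINT x|lebesgue_on {0..T}. q x)) \<longlongrightarrow>
      b (F 0) (G 0) + \<i> * (LINT x|half_line. q x)) at_top"
    by (intro tendsto_intros integral_interval_tendsto_half_line q)
  moreover have "\<forall>\<^sub>F T in at_top. b (F 0) (G 0) + \<i> * (LINT x|lebesgue_on {0..T}. q x) = b (F T) (G T)"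
    using eventually_ge_at_top[of 0] by eventually_elim (rule eq[symmetric])
  ultimately have lim: "((\<lambda>T. b (F T) (G T)) \<longlongrightarrow> b (F 0) (G 0) + \<i> * (LINT x|half_line. q x)) at_top"
    by (rule Lim_transform_eventually)
  have "integrable half_line (\<lambda>x. b (F x) (G x))"
  proof (rule integrable_cong_AE_imp)
    show "integrable half_line (\<lambda>x. b (f x) (g x))"
      by (rule L2_integrable_bilinear[OF b]) (use defs in auto)
    have "AE x in half_line. f x = F x" "AE x in half_line. g x = G x" using defs by auto
    then show "AE x in half_line. b (f x) (g x) = b (F x) (G x)"
      by eventually_elim simp
    show "(\<lambda>x. b (F x) (G x)) \<in> borel_measurable half_line"
      by (rule continuous_imp_measurable_on_sets_lebesgue[OF bounded_bilinear.continuous_on[OF b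
            abs_cont_continuous_on[OF F] abs_cont_continuous_on[OF G]]]) auto
  qed
  from integrable_half_line_limit_zero[OF this lim]
  have "b (F 0) (G 0) = - (\<i> * (LINT x|half_line. q x))" by (simp add: eq_neg_iff_add_eq_0)
  then have "\<i> * b (F 0) (G 0) = (LINT x|half_line. q x)" by (simp add: mult.assoc[symmetric])
  also have "\<dots> = L2_inner h g - L2_inner f k"
    using i1 i2 by (simp add: q_def L2_inner_def)
  finally show ?thesis by (simp add: b_def)
qed

lemma bounded_linear_matrix_scale: "bounded_linear (\<lambda>v::complex^'m. B *v (c *s v))"
  by (rule bounded_linear_compose[OF matrix_vector.bounded_linear_right bounded_linear_scale])

text \<open>Vanishing beyond \<open>T\<close> keeps \<open>Q x *v F x\<close> square-integrable
  however fast \<open>Q\<close> grows. No condition is imposed at 0, so the lemma serves both for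
  prescribed boundary values and for the dense class.\<close>

lemma maximal_graph_C1:
  assumes F: "\<And>x. (F has_vector_derivative w x) (at x)" and w: "continuous_on UNIV w"
    and F0: "\<And>x. x > T \<Longrightarrow> F x = 0" and w0: "\<And>x. x > T \<Longrightarrow> w x = 0"
    and Q: "continuous_on {0..} Q"
  shows "maximal_graph B Q F (\<lambda>x. B *v ((1 / \<i>) *s w x) + Q x *v F x) F w"
proof -
  have contF: "continuous_on {0..} F"
    using F by (meson continuous_at_imp_continuous_on has_vector_derivative_continuous)
  have contw: "continuous_on {0..} w" by (rule continuous_on_subset[OF w]) auto
  have "F \<in> L2" by (rule L2_continuous_cutoff[OF contF F0])
  moreover have "(\<lambda>x. B *v ((1 / \<i>) *s w x) + Q x *v F x) \<in> L2"
  proof (rule L2_continuous_cutoff)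
    show "continuous_on {0..} (\<lambda>x. B *v ((1 / \<i>) *s w x) + Q x *v F x)"
      by (rule continuous_on_add[OF bounded_linear.continuous_on[OF bounded_linear_matrix_scale contw]
            matrix_vector.continuous_on[OF Q contF]])
    show "B *v ((1 / \<i>) *s w x) + Q x *v F x = 0" if "x > T" for x
      using w0[OF that] F0[OF that] by simp
  qed
  moreover have "abs_cont F w" using F w by (rule abs_cont_C1)
  ultimately show ?thesis by (simp add: maximal_graph_def)
qed

lemma minimal_op_imp_maximal_graph:
  assumes "(u, v) \<in> minimal_op B Q"
  obtains F w where "maximal_graph B Q u v F w" "F 0 = 0"
proof -
  from assms obtain u' K where u: "u \<in> L2" "v \<in> L2" "u' \<in> L2" "has_weak_derivative u u'"
    and v: "AE x in half_line. v x = B *v ((1 / \<i>) *s u' x) + Q x *v u x"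
    and K: "compact K" "K \<subseteq> {0<..}" "AE x in half_line. x \<notin> K \<longrightarrow> u x = 0"
    unfolding minimal_op_def H1_comp_def H1_def by blast
  obtain F where F: "abs_cont F u'" "AE x in half_line. u x = F x"
  proof (rule weak_derivative_imp_abs_cont[of u u'])
    show "(LINT x|half_line. deriv \<phi> x *\<^sub>R u x) = - (LINT x|half_line. \<phi> x *\<^sub>R u' x)"
      if "test_function \<phi>" for \<phi>
      using u(4) that unfolding has_weak_derivative_def by blast
  qed (use u L2_locally_integrable in auto)
  have "\<exists>a>0. \<forall>x\<in>K. a \<le> x"
  proof (cases "K = {}")
    case False
    then obtain a where "a \<in> K" "\<forall>x\<in>K. a \<le> x" using compact_attains_inf[OF K(1)] by blast
    with K(2) show ?thesis by auto
  qed (auto intro: exI[of _ 1])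
  then obtain a where a: "a > 0" "\<forall>x\<in>K. a \<le> x" by blast
  have "F 0 = 0"
  proof (rule continuous_AE_zero_imp_zero_at_0[OF abs_cont_continuous_on[OF F(1)] _ a(1)])
    show "AE x in half_line. x < a \<longrightarrow> F x = 0"
      using K(3) F(2)
    proof eventually_elim
      case (elim x)
      with a(2) have "x < a \<Longrightarrow> x \<notin> K" by fastforce
      with elim show ?case by simp
    qed
  qed
  moreover have "maximal_graph B Q u v F u'"
    unfolding maximal_graph_def using u F v by simp
  ultimately show thesis using that by blast
qed

subsection \<open>The adjoint of the minimal operator\<close>

text \<open>Pairing with these elements turns the adjoint relation into the weak derivative
  identity, one direction \<open>c\<close> at a time.\<close>

lemma test_function_minimal_op:
  fixes c :: "complex^'m"
  assumes \<phi>: "test_function \<phi>" and Q: "continuous_on {0..} Q"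
  shows "(\<lambda>x. \<phi> x *\<^sub>R c, \<lambda>x. B *v ((1 / \<i>) *s (deriv \<phi> x *\<^sub>R c)) + Q x *v (\<phi> x *\<^sub>R c)) \<in> minimal_op B Q"
    (is "(?u, ?v) \<in> _")
proof -
  from \<phi> obtain a b where ab: "smooth \<phi>" "0 < a" "a < b" "\<forall>x. x \<notin> {a<..<b} \<longrightarrow> \<phi> x = 0"
    by (auto simp: test_function_iff)
  have deriv0: "deriv \<phi> x = 0" if "x > b" for x
    using deriv_eq_0_outside[OF ab(1,4), of x] that by auto
  have d: "(?u has_vector_derivative deriv \<phi> x *\<^sub>R c) (at x)" for x
  proof -
    have "(\<phi> has_vector_derivative deriv \<phi> x) (at x)"
      using smooth_has_deriv[OF ab(1)] by (simp add: has_real_derivative_iff_has_vector_derivative)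
    then show ?thesis
      by (rule bounded_linear.has_vector_derivative[OF bounded_linear_scaleR_left])
  qed
  have cont: "continuous_on S (\<lambda>x. deriv \<phi> x *\<^sub>R c)" for S
    by (intro continuous_intros smooth_continuous_on smooth_deriv ab)
  have max: "maximal_graph B Q ?u ?v ?u (\<lambda>x. deriv \<phi> x *\<^sub>R c)"
    by (rule maximal_graph_C1[OF d cont _ _ Q, of b]) (use ab deriv0 in auto)
  have u': "(\<lambda>x. deriv \<phi> x *\<^sub>R c) \<in> L2"
    by (rule L2_continuous_cutoff[OF cont, of b]) (simp add: deriv0)
  have "has_weak_derivative ?u (\<lambda>x. deriv \<phi> x *\<^sub>R c)"
    unfolding has_weak_derivative_def
  proof (intro allI impI)
    fix \<xi> assume \<xi>: "test_function \<xi>"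
    then have s\<xi>: "smooth \<xi>" "\<xi> 0 = 0" by (auto simp: test_function_iff)
    have ac: "abs_cont \<xi> (deriv \<xi>)"
      using smooth_has_deriv[OF s\<xi>(1)] smooth_continuous_on[OF smooth_deriv[OF s\<xi>(1)]]
      by (intro abs_cont_C1) (auto simp: has_real_derivative_iff_has_vector_derivative)
    have ac': "abs_cont ?u (\<lambda>x. deriv \<phi> x *\<^sub>R c)"
      using max by (simp add: maximal_graph_def)
    have "?u b = 0" using ab by auto
    with integral_by_parts(2)[OF bounded_bilinear_scaleR ac ac', of b] s\<xi> ab(2,3)
    have "(LINT x|lebesgue_on {0..b}. deriv \<xi> x *\<^sub>R ?u x + \<xi> x *\<^sub>R (deriv \<phi> x *\<^sub>R c)) = 0"
      by simp
    then have 0: "(LINT x|half_line. deriv \<xi> x *\<^sub>R ?u x + \<xi> x *\<^sub>R (deriv \<phi> x *\<^sub>R c)) = 0"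
      by (subst integral_half_line_cutoff[of b]) (use ab deriv0 in auto)
    have "integrable half_line (\<lambda>x. deriv \<xi> x *\<^sub>R ?u x)"
      using max by (intro integrable_test_scaleR test_function_deriv \<xi> L2_locally_integrable)
        (simp add: maximal_graph_def)
    moreover have "integrable half_line (\<lambda>x. \<xi> x *\<^sub>R (deriv \<phi> x *\<^sub>R c))"
      by (intro integrable_test_scaleR \<xi> L2_locally_integrable u')
    ultimately show "(LINT x|half_line. deriv \<xi> x *\<^sub>R ?u x) = - (LINT x|half_line. \<xi> x *\<^sub>R (deriv \<phi> x *\<^sub>R c))"
      using 0 by (simp only: Bochner_Integration.integral_add eq_neg_iff_add_eq_0)
  qed
  moreover have "\<exists>K. compact K \<and> K \<subseteq> {0<..} \<and> (AE x in half_line. x \<notin> K \<longrightarrow> ?u x = 0)"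
    by (intro exI[of _ "{a..b}"]) (use ab in auto)
  ultimately show ?thesis
    using max u' unfolding minimal_op_def H1_comp_def H1_def maximal_graph_def
    by (intro CollectI case_prodI conjI bexI[of _ "\<lambda>x. deriv \<phi> x *\<^sub>R c"]) auto
qed

lemma op_adjoint_minimal_op_imp_maximal_graph:
  fixes B A :: "complex^'m^'m"
  assumes B: "self_adjoint_matrix B" and inv: "A ** B = mat 1" "B ** A = mat 1"
    and Qc: "continuous_on {0..} Q" and Q: "\<And>x. x \<ge> 0 \<Longrightarrow> self_adjoint_matrix (Q x)"
    and gh: "(g, h) \<in> op_adjoint (minimal_op B Q)"
  obtains G w where "maximal_graph B Q g h G w"
proof -
  from gh have L2: "g \<in> L2" "h \<in> L2" by (auto simp: op_adjoint_def)
  define e where "e x = h x - Q x *v g x" for x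
  \<comment> \<open>The candidate derivative: the solution \<open>w\<close> of h = B (1/i) w + Q g.
    It is locally integrable because the continuous \<open>Q\<close> is bounded on bounded
    intervals.\<close>
  define w where "w x = A *v (\<i> *s e x)" for x
  have Bw: "B *v w x = \<i> *s e x" for x
    unfolding w_def matrix_vector_mul_assoc inv by simp
  have g: "integrable (lebesgue_on {0..T}) g" for T by (rule L2_locally_integrable[OF L2(1)])
  have "integrable (lebesgue_on {0..T}) (\<lambda>x. Q x *v g x)" for T
    by (rule integrable_continuous_bilinear[OF bounded_bilinear_matrix_vector continuous_on_subset[OF Qc] g]) auto
  then have "integrable (lebesgue_on {0..T}) e" for T
    unfolding e_def by (rule Bochner_Integration.integrable_diff[OF L2_locally_integrable[OF L2(2)]])
  then have w: "integrable (lebesgue_on {0..T}) w" for T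
    unfolding w_def by (rule integrable_bounded_linear[OF bounded_linear_matrix_scale])
  obtain G where G: "abs_cont G w" "AE x in half_line. g x = G x"
  proof (rule weak_derivative_imp_abs_cont[of g w])
    fix \<phi> assume \<phi>: "test_function \<phi>"
    have i1: "integrable half_line (\<lambda>x. deriv \<phi> x *\<^sub>R g x)"
      by (intro integrable_test_scaleR test_function_deriv \<phi> g)
    have i2: "integrable half_line (\<lambda>x. \<phi> x *\<^sub>R w x)"
      by (intro integrable_test_scaleR \<phi> w)
    define s where "s x = deriv \<phi> x *\<^sub>R g x + \<phi> x *\<^sub>R w x" for x
    have s: "integrable half_line s" unfolding s_def by (intro Bochner_Integration.integrable_add i1 i2)
    \<comment> \<open>The adjoint relation for the pair built from \<open>\<phi>\<close> and
      \<open>c\<close>, with both sides rewritten through \<open>w\<close>. As \<open>B\<close> is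
      onto, the vectors \<open>B *v c\<close> detect that the integral of \<open>s\<close>
      vanishes.\<close>
    have zero: "cinner (B *v c) (LINT x|half_line. s x) = 0" for c
    proof -
      define u where "u x = \<phi> x *\<^sub>R c" for x
      define v where "v x = B *v ((1 / \<i>) *s (deriv \<phi> x *\<^sub>R c)) + Q x *v (\<phi> x *\<^sub>R c)" for x
      have uv: "(u, v) \<in> minimal_op B Q"
        unfolding u_def[abs_def] v_def[abs_def] by (rule test_function_minimal_op[OF \<phi> Qc])
      then have uvL2: "u \<in> L2" "v \<in> L2" by (auto simp: minimal_op_def H1_comp_def H1_def)
      have "- (\<i> * cinner (B *v c) (LINT x|half_line. s x)) = (LINT x|half_line. - (\<i> * cinner (B *v c) (s x)))"
        using integrable_bounded_linear[OF cinner.bounded_linear_right s]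
        by (simp add: integral_bounded_linear[OF cinner.bounded_linear_right s])
      also have "\<dots> = (LINT x|half_line. cinner (v x) (g x) - cinner (u x) (h x))"
      proof (rule Bochner_Integration.integral_cong[OF refl])
        fix x :: real assume "x \<in> space half_line"
        then have Qx: "cinner (Q x *v c) (g x) = cinner c (Q x *v g x)"
          by (intro cinner_self_adjoint Q) auto
        define r where "r = cinner c (h x) - cinner c (Q x *v g x)"
        have Bcw: "cinner (B *v c) (w x) = - \<i> * r"
          unfolding cinner_self_adjoint[OF B] Bw by (simp add: r_def e_def cinner.diff_right right_diff_distrib)
        have "- (\<i> * cinner (B *v c) (s x)) = - \<i> * (deriv \<phi> x *\<^sub>R cinner (B *v c) (g x)) - \<phi> x *\<^sub>R r"
          unfolding s_def cinner.add_right cinner.scaleR_right Bcw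
          by (simp add: scaleR_conv_of_real algebra_simps)
        moreover have "cinner (v x) (g x) - cinner (u x) (h x) = (1 / \<i>) * (deriv \<phi> x *\<^sub>R cinner (B *v c) (g x))
            + \<phi> x *\<^sub>R cinner c (Q x *v g x) - \<phi> x *\<^sub>R cinner c (h x)"
          unfolding v_def u_def cinner.add_left matrix_vector_scale cinner_scale_left
            matrix_vector.scaleR_right cinner.scaleR_left Qx by simp
        ultimately show "- (\<i> * cinner (B *v c) (s x)) = cinner (v x) (g x) - cinner (u x) (h x)"
          by (simp add: r_def scaleR_diff_right)
      qed
      also have "\<dots> = L2_inner v g - L2_inner u h"
        unfolding L2_inner_def
        by (intro Bochner_Integration.integral_diff L2_integrable_bilinear[OF bounded_bilinear_cinner] L2 uvL2)
      also have "\<dots> = 0" using gh uv by (auto simp: op_adjoint_def)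
      finally show ?thesis by simp
    qed
    have "(LINT x|half_line. s x) = 0"
    proof (rule cinner_eq_0_imp)
      fix c
      have "B *v (A *v c) = c" by (simp add: matrix_vector_mul_assoc inv)
      with zero[of "A *v c"] show "cinner c (LINT x|half_line. s x) = 0" by simp
    qed
    then show "(LINT x|half_line. deriv \<phi> x *\<^sub>R g x) = - (LINT x|half_line. \<phi> x *\<^sub>R w x)"
      using i1 i2 by (simp add: s_def eq_neg_iff_add_eq_0)
  qed (use g w in auto)
  have "h x = B *v ((1 / \<i>) *s w x) + Q x *v g x" for x
    unfolding matrix_vector_scale Bw by (simp add: e_def vec_eq_iff)
  then have "maximal_graph B Q g h G w"
    unfolding maximal_graph_def using L2 G by simp
  then show thesis by (rule that)
qed

lemma op_adjoint_minimal_op: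
  fixes B :: "complex^'m^'m"
  assumes B: "self_adjoint_matrix B" "invertible B"
    and Q: "continuous_on {0..} Q" "\<And>x. x \<ge> 0 \<Longrightarrow> self_adjoint_matrix (Q x)"
  shows "op_adjoint (minimal_op B Q) = {(f, h). \<exists>F w. maximal_graph B Q f h F w}"
proof safe
  fix f h assume "(f, h) \<in> op_adjoint (minimal_op B Q)"
  then show "\<exists>F w. maximal_graph B Q f h F w"
    using op_adjoint_minimal_op_imp_maximal_graph[OF B(1) _ _ Q] B(2) unfolding invertible_def by metis
next
  fix f h F w assume f: "maximal_graph B Q f h F w"
  have "L2_inner v f = L2_inner u h" if uv: "(u, v) \<in> minimal_op B Q" for u v
  proof -
    from uv obtain U z where U: "maximal_graph B Q u v U z" "U 0 = 0" by (rule minimal_op_imp_maximal_graph)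
    from green_formula[OF B(1) Q(2) U(1) f] U(2) show ?thesis by (simp add: cinner.zero_left)
  qed
  with f show "(f, h) \<in> op_adjoint (minimal_op B Q)"
    by (auto simp: op_adjoint_def maximal_graph_def)
qed

lemma maximal_graph_value_at_0: "maximal_graph B Q f h F w \<Longrightarrow> value_at_0 f = F 0"
  unfolding maximal_graph_def by (blast intro: value_at_0_eq abs_cont_continuous_on)

text \<open>Surjectivity of the boundary map: it allows statements about all functions in a domain
  to be tested on all vectors of \<open>V\<close>.\<close>

lemma maximal_graph_with_value:
  fixes c :: "complex^'m"
  assumes "continuous_on {0..} Q"
  obtains f h F w where "maximal_graph B Q f h F w" "F 0 = c"
proof -
  \<comment> \<open>This is exp(-1/(1 - x)) for x < 1 and 0 afterwards: a smooth cut-off on the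
    right that is nonzero at 0.\<close>
  define \<eta> where "\<eta> x = flat_exp 1 ((- 1) * x + 1)" for x
  have s: "smooth \<eta>" unfolding \<eta>_def[abs_def] by (intro smooth_affine smooth_flat_exp)
  have \<eta>0: "\<eta> 0 \<noteq> 0" by (simp add: \<eta>_def flat_exp_def)
  have z: "\<eta> x = 0" if "x > 1" for x using that by (simp add: \<eta>_def flat_exp_def)
  have "deriv \<eta> x = 0" if "x > 1" for x
  proof -
    have "\<forall>\<^sub>F y in nhds x. \<eta> y = 0"
      by (rule eventually_mono[OF eventually_nhds_in_open[of "{1<..}" x]]) (use that z in auto)
    then have "(\<eta> has_real_derivative 0) (at x)"
      by (subst DERIV_cong_ev[OF refl _ refl]) auto
    then show ?thesis by (rule DERIV_imp_deriv)
  qed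
  then have d0: "deriv \<eta> x *\<^sub>R (c /\<^sub>R \<eta> 0) = 0" if "x > 1" for x using that by simp
  have d: "((\<lambda>x. \<eta> x *\<^sub>R (c /\<^sub>R \<eta> 0)) has_vector_derivative deriv \<eta> x *\<^sub>R (c /\<^sub>R \<eta> 0)) (at x)" for x
  proof -
    have "(\<eta> has_vector_derivative deriv \<eta> x) (at x)"
      using smooth_has_deriv[OF s] by (simp add: has_real_derivative_iff_has_vector_derivative)
    then show ?thesis
      by (rule bounded_linear.has_vector_derivative[OF bounded_linear_scaleR_left])
  qed
  have cont: "continuous_on UNIV (\<lambda>x. deriv \<eta> x *\<^sub>R (c /\<^sub>R \<eta> 0))"
    by (intro continuous_intros smooth_continuous_on smooth_deriv s)
  have z': "\<eta> x *\<^sub>R (c /\<^sub>R \<eta> 0) = 0" if "x > 1" for x using z[OF that] by simp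
  show thesis
    by (rule that[OF maximal_graph_C1[OF d cont z' d0 assms]]) (use \<eta>0 in auto)
qed

subsection \<open>Density\<close>

lemma L2_truncation:
  fixes f :: "real \<Rightarrow> complex^'m"
  assumes f: "f \<in> L2" and "0 < d"
  obtains f' M where "f' \<in> borel_measurable half_line" "M \<ge> 1" "\<And>x. norm (f' x) \<le> M"
    "\<And>x. x \<notin> {1 / M<..<M} \<Longrightarrow> f' x = 0"
    "integrable half_line (\<lambda>x. (norm (f x - f' x))\<^sup>2)" "(LINT x|half_line. (norm (f x - f' x))\<^sup>2) < d"
proof -
  \<comment> \<open>Small x, large x and large values of \<open>f\<close> are cut off by the same
    index. The remaining error is dominated by the square of the norm of \<open>f\<close> and tends
    to 0 for every x > 0.\<close>
  define S where "S n = {x \<in> space half_line. 1 / real (Suc n) < x \<and> x < real (Suc n) \<and> norm (f x) \<le> real (Suc n)}" for n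
  define F where "F n x = indicator (S n) x *\<^sub>R f x" for n x
  have [measurable]: "f \<in> borel_measurable half_line" using f by (simp add: L2_def)
  have [measurable]: "(\<lambda>x. x) \<in> borel_measurable half_line"
    by (intro measurable_restrict_space1 measurable_completion) simp
  have [measurable]: "S n \<in> sets half_line" for n unfolding S_def by measurable
  have mF [measurable]: "F n \<in> borel_measurable half_line" for n unfolding F_def by measurable
  have int: "integrable half_line (\<lambda>x. (norm (f x))\<^sup>2)" using f by (simp add: L2_def)
  have le: "(norm (f x - F n x))\<^sup>2 \<le> (norm (f x))\<^sup>2" for n x
    by (simp add: F_def indicator_def)
  have intF: "integrable half_line (\<lambda>x. (norm (f x - F n x))\<^sup>2)" for n
    by (rule Bochner_Integration.integrable_bound[OF int]) (use le in auto)
  have "(\<lambda>n. LINT x|half_line. (norm (f x - F n x))\<^sup>2) \<longlonglongrightarrow> (LINT x|half_line. 0)"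
  proof (rule integral_dominated_convergence[OF _ _ int])
    show "AE x in half_line. norm ((norm (f x - F n x))\<^sup>2) \<le> (norm (f x))\<^sup>2" for n
      using le by (intro AE_I2) simp
    have "AE x in lebesgue. x \<noteq> (0::real)" by (intro AE_completion AE_lborel_singleton)
    then have "AE x in half_line. x \<noteq> 0" by (subst AE_restrict_space_iff) auto
    then show "AE x in half_line. (\<lambda>n. (norm (f x - F n x))\<^sup>2) \<longlonglongrightarrow> 0"
      using AE_space
    proof eventually_elim
      case (elim x)
      then have x: "x > 0" by simp
      obtain n0 :: nat where n0: "1 / x + x + norm (f x) < n0" using reals_Archimedean2 by blast
      have "\<forall>\<^sub>F n in sequentially. (0::real) = (norm (f x - F n x))\<^sup>2"
      proof (rule eventually_mono[OF eventually_ge_at_top[of n0]])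
        fix n assume "n0 \<le> n"
        then have n: "1 / x + x + norm (f x) < real (Suc n)" using n0 by simp
        moreover have "0 < 1 / x" using x by simp
        ultimately have l: "1 / x < real (Suc n)" "x < real (Suc n)" "norm (f x) \<le> real (Suc n)"
          using x norm_ge_zero[of "f x"] by linarith+
        have "1 / real (Suc n) < x" using l(1) x by (simp add: field_simps)
        with l elim have "x \<in> S n" by (simp add: S_def)
        then show "(0::real) = (norm (f x - F n x))\<^sup>2" by (simp add: F_def)
      qed
      then show ?case by (rule Lim_transform_eventually[OF tendsto_const])
    qed
  qed measurable
  then have "\<forall>\<^sub>F n in sequentially. (LINT x|half_line. (norm (f x - F n x))\<^sup>2) < d"
    using \<open>0 < d\<close> by (intro order_tendstoD) auto
  then obtain n where n: "(LINT x|half_line. (norm (f x - F n x))\<^sup>2) < d"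
    using eventually_happens by force
  show thesis
  proof (rule that[OF mF _ _ _ intF n])
    show "1 \<le> real (Suc n)" by simp
    show "norm (F n x) \<le> real (Suc n)" for x by (auto simp: F_def S_def indicator_def)
    show "F n x = 0" if "x \<notin> {1 / real (Suc n)<..<real (Suc n)}" for x
      using that by (auto simp: F_def S_def indicator_def)
  qed
qed

text \<open>Continuous functions converging to \<open>f\<close> almost everywhere come with
  measurability, but need be neither bounded nor differentiable nor compactly supported. Clipping,
  Stone-Weierstrass polynomials and bumps supply these properties in turn, and dominated convergence
  on the bounded interval finishes.\<close>

lemma L2_approximation_C1:
  fixes f :: "real \<Rightarrow> complex^'m"
  assumes f: "f \<in> borel_measurable half_line" and M: "M \<ge> 1" "\<And>x. norm (f x) \<le> M"
    "\<And>x. x \<notin> {1 / M<..<M} \<Longrightarrow> f x = 0" and "0 < d"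
  obtains u u' where "\<And>x. (u has_vector_derivative u' x) (at x)" "continuous_on UNIV u'"
    "\<And>x. x \<notin> {1 / M<..<M} \<Longrightarrow> u x = 0" "\<And>x. x > M \<Longrightarrow> u' x = 0"
    "integrable half_line (\<lambda>x. (norm (f x - u x))\<^sup>2)" "(LINT x|half_line. (norm (f x - u x))\<^sup>2) < d"
proof -
  define a where "a = 1 / M"
  have a: "0 < a" "a \<le> 1" "a \<le> M" using M(1) by (auto simp: a_def intro: order_trans[of _ 1])
  have "f measurable_on {0..}" using f by (simp add: measurable_on_iff_borel_measurable)
  then obtain N g where N: "negligible N" and g: "\<And>n. continuous_on UNIV (g n)"
    and lim: "\<And>x. x \<notin> N \<Longrightarrow> (\<lambda>n. g n x) \<longlonglongrightarrow> (if x \<in> {0..} then f x else 0)"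
    unfolding measurable_on_def by metis
  \<comment> \<open>Radial projection onto the ball of radius \<open>M\<close>. It is continuous and
    fixes the values of \<open>f\<close>, so the limit is unchanged.\<close>
  define v where "v n x = (M / max M (norm (g n x))) *\<^sub>R g n x" for n :: nat and x
  have pos: "0 < max M (norm (g n x))" for n x using M(1) by (simp add: less_max_iff_disj)
  have contv: "continuous_on S (v n)" for S n
  proof -
    have "continuous_on UNIV (v n)"
      unfolding v_def using g pos by (intro continuous_intros) (auto simp: less_imp_neq[symmetric] simp del: max_less_iff_conj)
    then show ?thesis by (rule continuous_on_subset) simp
  qed
  have v_le: "norm (v n x) \<le> M" for n x
  proof -
    have "norm (v n x) = M * (norm (g n x) / max M (norm (g n x)))"
      using M(1) pos[of n x] by (simp add: v_def)
    also have "\<dots> \<le> M * 1"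
      using M(1) pos[of n x] by (intro mult_left_mono) (auto simp: divide_le_eq_1)
    finally show ?thesis by simp
  qed
  have v_lim: "(\<lambda>n. v n x) \<longlonglongrightarrow> f x" if "x \<notin> N" "x \<ge> 0" for x
  proof -
    have "(\<lambda>n. g n x) \<longlonglongrightarrow> f x" using lim[OF that(1)] that(2) by simp
    then have "(\<lambda>n. v n x) \<longlonglongrightarrow> (M / max M (norm (f x))) *\<^sub>R f x"
      unfolding v_def using M by (intro tendsto_intros) auto
    then show ?thesis using M(1) M(2)[of x] by (simp add: max_absorb1)
  qed
  have "\<exists>P. polynomial_function P \<and> (\<forall>x\<in>{a..M}. norm (v n x - P x) < 1 / real (Suc n))" for n
    by (intro Stone_Weierstrass_polynomial_function contv) auto
  then obtain P where P: "\<And>n. polynomial_function (P n)"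
    "\<And>n x. x \<in> {a..M} \<Longrightarrow> norm (v n x - P n x) < 1 / real (Suc n)" by metis
  have "\<exists>P'. polynomial_function P' \<and> (\<forall>x. (P n has_vector_derivative P' x) (at x))" for n
    using has_vector_derivative_polynomial_function[OF P(1)] by metis
  then obtain P' where P': "\<And>n. polynomial_function (P' n)"
    "\<And>n x. (P n has_vector_derivative P' n x) (at x)" by metis
  define u where "u n x = bump a M n x *\<^sub>R P n x" for n x
  have u0: "u n x = 0" if "x \<notin> {a<..<M}" for n x
    using bump_eq_0[OF that] by (simp add: u_def)
  have contu: "continuous_on S (u n)" for S n
    unfolding u_def by (intro continuous_intros smooth_continuous_on smooth_bump continuous_on_polymonial_function P)
  have u_lim: "(\<lambda>n. u n x) \<longlonglongrightarrow> f x" if "x \<notin> N" "x \<ge> 0" for x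
  proof (cases "x \<in> {a<..<M}")
    case True
    have "(\<lambda>n. v n x - P n x) \<longlonglongrightarrow> 0"
    proof (rule Lim_null_comparison)
      show "(\<lambda>n. 1 / real (Suc n)) \<longlonglongrightarrow> 0" by (rule LIMSEQ_Suc[OF lim_1_over_n])
      show "\<forall>\<^sub>F n in sequentially. norm (v n x - P n x) \<le> 1 / real (Suc n)"
        using P(2) True by (intro always_eventually allI less_imp_le) auto
    qed
    then have "(\<lambda>n. v n x - (v n x - P n x)) \<longlonglongrightarrow> f x - 0"
      by (intro tendsto_diff v_lim that)
    then have "(\<lambda>n. bump a M n x *\<^sub>R P n x) \<longlonglongrightarrow> indicator {a<..<M} x *\<^sub>R f x"
      by (intro tendsto_scaleR bump_tendsto_indicator) simp
    with True show ?thesis by (simp add: u_def)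
  next
    case False
    with u0 M(3) show ?thesis by (simp add: a_def)
  qed
  have u_le: "norm (u n x) \<le> M + 1" for n x
  proof (cases "x \<in> {a<..<M}")
    case True
    have "norm (P n x) \<le> norm (v n x) + norm (v n x - P n x)"
      using norm_triangle_ineq4[of "v n x" "v n x - P n x"] by simp
    moreover have "1 / real (Suc n) \<le> 1" by simp
    moreover have "norm (v n x - P n x) < 1 / real (Suc n)" using True by (intro P(2)) simp
    ultimately have "norm (P n x) \<le> M + 1" using v_le[of n x] by linarith
    moreover have "norm (u n x) \<le> norm (P n x)"
      using bump_bounds[of a M n x] by (simp add: u_def mult_left_le_one_le)
    ultimately show ?thesis by simp
  next
    case False
    with u0 M(1) show ?thesis by simp
  qed
  \<comment> \<open>The constant adds the bound \<open>M\<close> for \<open>f\<close> and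
    \<open>M + 1\<close> for \<open>u n\<close>, where the extra 1 is the polynomial error.\<close>
  define bound where "bound x = indicator {a<..<M} x *\<^sub>R (2 * M + 1)\<^sup>2" for x :: real
  have int_bound: "integrable half_line bound"
  proof -
    have "{a<..<M} \<in> sets half_line" using a by (auto simp: sets_restrict_space_iff)
    moreover have "emeasure half_line {a<..<M} = emeasure lebesgue {a<..<M}"
      by (rule emeasure_restrict_space) (use a in auto)
    ultimately show ?thesis
      unfolding bound_def using a by (intro integrable_scaleR_left integrable_real_indicator) auto
  qed
  have le: "(norm (f x - u n x))\<^sup>2 \<le> bound x" for n x
  proof (cases "x \<in> {a<..<M}")
    case True
    have "norm (f x - u n x) \<le> 2 * M + 1"
      using norm_triangle_ineq4[of "f x" "u n x"] M(2)[of x] u_le[of n x] by linarith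
    then have "(norm (f x - u n x))\<^sup>2 \<le> (2 * M + 1)\<^sup>2" by (intro power_mono) auto
    with True show ?thesis by (simp add: bound_def)
  next
    case False
    with u0[of x n] M(3)[of x] show ?thesis by (simp add: bound_def a_def)
  qed
  have mu: "u n \<in> borel_measurable half_line" for n
    by (rule continuous_imp_measurable_on_sets_lebesgue[OF contu]) auto
  have meas: "(\<lambda>x. (norm (f x - u n x))\<^sup>2) \<in> borel_measurable half_line" for n
    using f mu[of n] by measurable
  have intu: "integrable half_line (\<lambda>x. (norm (f x - u n x))\<^sup>2)" for n
    by (rule Bochner_Integration.integrable_bound[OF int_bound meas])
      (use le in \<open>auto intro!: AE_I2 order_trans[OF le abs_ge_self]\<close>)
  have "(\<lambda>n. LINT x|half_line. (norm (f x - u n x))\<^sup>2) \<longlonglongrightarrow> (LINT x|half_line. 0)"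
  proof (rule integral_dominated_convergence[OF _ meas int_bound])
    show "AE x in half_line. norm ((norm (f x - u n x))\<^sup>2) \<le> bound x" for n
      using le by (intro AE_I2) simp
    have "AE x in lebesgue. x \<notin> N"
      using N by (intro AE_not_in) (simp add: negligible_iff_null_sets)
    then have "AE x in half_line. x \<notin> N" by (subst AE_restrict_space_iff) auto
    then show "AE x in half_line. (\<lambda>n. (norm (f x - u n x))\<^sup>2) \<longlonglongrightarrow> 0"
      using AE_space
    proof eventually_elim
      case (elim x)
      then have "(\<lambda>n. (norm (f x - u n x))\<^sup>2) \<longlonglongrightarrow> (norm (f x - f x))\<^sup>2"
        by (intro tendsto_intros u_lim) auto
      then show ?case by simp
    qed
  qed simp
  then have "\<forall>\<^sub>F n in sequentially. (LINT x|half_line. (norm (f x - u n x))\<^sup>2) < d"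
    using \<open>0 < d\<close> by (intro order_tendstoD) auto
  then obtain n where n: "(LINT x|half_line. (norm (f x - u n x))\<^sup>2) < d"
    using eventually_happens by force
  define u' where "u' x = bump a M n x *\<^sub>R P' n x + deriv (bump a M n) x *\<^sub>R P n x" for x
  show thesis
  proof (rule that[of "u n" u'])
    show "(u n has_vector_derivative u' x) (at x)" for x
      unfolding u_def u'_def by (rule has_vector_derivative_scaleR[OF smooth_has_deriv[OF smooth_bump] P'(2)])
    show "continuous_on UNIV u'"
      unfolding u'_def
      by (intro continuous_intros smooth_continuous_on smooth_bump smooth_deriv continuous_on_polymonial_function P P')
    show "u n x = 0" if "x \<notin> {1 / M<..<M}" for x using u0[of x n] that by (simp add: a_def)
    show "u' x = 0" if "x > M" for x
      using that bump_eq_0[of x a M n] deriv_eq_0_outside[OF smooth_bump, of a M a M n x] bump_eq_0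
      by (simp add: u'_def)
  qed (use intu n in auto)
qed

text \<open>The approximants vanish at 0, so they satisfy every boundary condition under
  consideration.\<close>

lemma maximal_graph_dense:
  fixes f :: "real \<Rightarrow> complex^'m"
  assumes Q: "continuous_on {0..} Q" and f: "f \<in> L2" and "0 < e"
  obtains u h w where "maximal_graph B Q u h u w" "u 0 = 0" "L2_norm (\<lambda>x. f x - u x) < e"
proof -
  \<comment> \<open>The bound (s + t)^2 <= 2 s^2 + 2 t^2 doubles each of the two squared errors, so
    a quarter of \<open>e\<^sup>2\<close> for each adds up to \<open>e\<^sup>2\<close>.\<close>
  have "0 < e\<^sup>2 / 4" using \<open>0 < e\<close> by simp
  obtain f' M where f': "f' \<in> borel_measurable half_line" and M: "M \<ge> 1" "\<And>x. norm (f' x) \<le> M"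
    "\<And>x. x \<notin> {1 / M<..<M} \<Longrightarrow> f' x = 0"
    and int1: "integrable half_line (\<lambda>x. (norm (f x - f' x))\<^sup>2)"
    and lt1: "(LINT x|half_line. (norm (f x - f' x))\<^sup>2) < e\<^sup>2 / 4"
    by (rule L2_truncation[OF f \<open>0 < e\<^sup>2 / 4\<close>]) blast
  obtain u u' where u: "\<And>x. (u has_vector_derivative u' x) (at x)" "continuous_on UNIV u'"
    "\<And>x. x \<notin> {1 / M<..<M} \<Longrightarrow> u x = 0" "\<And>x. x > M \<Longrightarrow> u' x = 0"
    and int2: "integrable half_line (\<lambda>x. (norm (f' x - u x))\<^sup>2)"
    and lt2: "(LINT x|half_line. (norm (f' x - u x))\<^sup>2) < e\<^sup>2 / 4"
    by (rule L2_approximation_C1[OF f' M(1,2) _ \<open>0 < e\<^sup>2 / 4\<close>], erule M(3)) (rule that)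
  have "u x = 0" if "x > M" for x using u(3)[of x] that by simp
  then have max: "maximal_graph B Q u (\<lambda>x. B *v ((1 / \<i>) *s u' x) + Q x *v u x) u u'"
    using u by (intro maximal_graph_C1[OF _ _ _ _ Q, of _ _ M]) auto
  define r where "r x = 2 * (norm (f x - f' x))\<^sup>2 + 2 * (norm (f' x - u x))\<^sup>2" for x
  have le: "(norm (f x - u x))\<^sup>2 \<le> r x" for x
  proof -
    have "norm (f x - u x) \<le> norm (f x - f' x) + norm (f' x - u x)"
      using norm_triangle_ineq[of "f x - f' x" "f' x - u x"] by simp
    then have "(norm (f x - u x))\<^sup>2 \<le> (norm (f x - f' x) + norm (f' x - u x))\<^sup>2"
      by (intro power_mono) auto
    also have "\<dots> \<le> r x"
      using sum_squares_bound[of "norm (f x - f' x)" "norm (f' x - u x)"] by (simp add: r_def power2_sum)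
    finally show ?thesis .
  qed
  have int_r: "integrable half_line r" unfolding r_def using int1 int2 by simp
  have [measurable]: "u \<in> borel_measurable half_line" "f \<in> borel_measurable half_line"
    using max f by (simp_all add: maximal_graph_def L2_def)
  have "(\<lambda>x. (norm (f x - u x))\<^sup>2) \<in> borel_measurable half_line" by measurable
  then have int: "integrable half_line (\<lambda>x. (norm (f x - u x))\<^sup>2)"
    by (rule Bochner_Integration.integrable_bound[OF int_r])
      (intro AE_I2, use le in \<open>auto intro!: order_trans[OF le abs_ge_self]\<close>)
  have "(LINT x|half_line. (norm (f x - u x))\<^sup>2) \<le> (LINT x|half_line. r x)"
    by (intro integral_mono int int_r le)
  also have "\<dots> = 2 * (LINT x|half_line. (norm (f x - f' x))\<^sup>2) + 2 * (LINT x|half_line. (norm (f' x - u x))\<^sup>2)"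
    unfolding r_def using int1 int2 by simp
  also have "\<dots> < e\<^sup>2" using lt1 lt2 by simp
  finally have "L2_norm (\<lambda>x. f x - u x) < sqrt (e\<^sup>2)"
    unfolding L2_norm_def by (rule real_sqrt_less_mono)
  with \<open>0 < e\<close> have "L2_norm (\<lambda>x. f x - u x) < e" by simp
  moreover have "u 0 = 0" using M(1) by (intro u(3)) simp
  ultimately show thesis using that max by blast
qed

subsection \<open>Self-adjointness and Lagrangian boundary conditions\<close>

text \<open>By Green's formula the adjoint relation between two elements of the maximal graph says
  exactly that the form vanishes on their boundary values. Comparing \<open>op_adjoint T\<close>
  with \<open>T\<close> thus compares the orthogonal complement of \<open>V\<close> with
  \<open>V\<close>.\<close>

lemma self_adjoint_op_iff_lagrangian:
  fixes B :: "complex^'m^'m"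
  assumes B: "self_adjoint_matrix B" "invertible B"
    and Q: "continuous_on {0..} Q" "\<And>x. x \<ge> 0 \<Longrightarrow> self_adjoint_matrix (Q x)"
    and "0 \<in> V"
  defines "T \<equiv> {(f, h). \<exists>F w. maximal_graph B Q f h F w \<and> F 0 \<in> V}"
  shows "self_adjoint_op T \<longleftrightarrow> (\<forall>d. d \<in> V \<longleftrightarrow> (\<forall>c\<in>V. cinner (B *v c) d = 0))"
proof -
  note green = green_formula[OF B(1) Q(2)]
  have adjD: "cinner (B *v F 0) (G 0) = 0"
    if "(g, k) \<in> op_adjoint T" "maximal_graph B Q f h F w" "F 0 \<in> V" "maximal_graph B Q g k G z" for f h F w g k G z
  proof -
    have "(f, h) \<in> T" using that by (auto simp: T_def)
    with that(1) have "L2_inner h g = L2_inner f k" by (auto simp: op_adjoint_def)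
    with green[OF _ that(2,4)] show ?thesis by simp
  qed
  have adjI: "(g, k) \<in> op_adjoint T"
    if "maximal_graph B Q g k G z" "\<forall>c\<in>V. cinner (B *v c) (G 0) = 0" for g k G z
  proof -
    have "L2_inner h g = L2_inner f k" if "(f, h) \<in> T" for f h
    proof -
      from that obtain F w where F: "maximal_graph B Q f h F w" "F 0 \<in> V" by (auto simp: T_def)
      with green[OF _ F(1) \<open>maximal_graph B Q g k G z\<close>] \<open>\<forall>c\<in>V. cinner (B *v c) (G 0) = 0\<close>
      show ?thesis by simp
    qed
    with that(1) show ?thesis by (auto simp: op_adjoint_def maximal_graph_def)
  qed
  show ?thesis
  proof
    assume sa: "self_adjoint_op T"
    then have adj: "op_adjoint T = T" by (simp add: self_adjoint_op_def)
    show "\<forall>d. d \<in> V \<longleftrightarrow> (\<forall>c\<in>V. cinner (B *v c) d = 0)"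
    proof (intro allI iffI ballI)
      fix c d assume "d \<in> V" "c \<in> V"
      obtain f h F w where F: "maximal_graph B Q f h F w" "F 0 = c" by (rule maximal_graph_with_value[OF Q(1)])
      obtain g k G z where G: "maximal_graph B Q g k G z" "G 0 = d" by (rule maximal_graph_with_value[OF Q(1)])
      have "(g, k) \<in> T" using G \<open>d \<in> V\<close> by (auto simp: T_def)
      then show "cinner (B *v c) d = 0"
        using adjD[OF _ F(1) _ G(1)] adj F(2) G(2) \<open>c \<in> V\<close> by simp
    next
      fix d assume d: "\<forall>c\<in>V. cinner (B *v c) d = 0"
      obtain g k G z where G: "maximal_graph B Q g k G z" "G 0 = d" by (rule maximal_graph_with_value[OF Q(1)])
      with adjI[OF G(1)] d adj have "(g, k) \<in> T" by simp
      then obtain G' z' where "maximal_graph B Q g k G' z'" "G' 0 \<in> V" by (auto simp: T_def)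
      \<comment> \<open>Membership in \<open>T\<close> may come with another representative
        \<open>G'\<close>. Its value at 0 is still \<open>d\<close>, as \<open>value_at_0\<close>
        depends on \<open>g\<close> alone.\<close>
      with G show "d \<in> V" by (metis maximal_graph_value_at_0)
    qed
  next
    assume lag: "\<forall>d. d \<in> V \<longleftrightarrow> (\<forall>c\<in>V. cinner (B *v c) d = 0)"
    have "densely_defined T"
      unfolding densely_defined_def
    proof (intro ballI allI impI)
      fix f :: "real \<Rightarrow> complex^'m" and e :: real assume "f \<in> L2" "0 < e"
      obtain u h w where "maximal_graph B Q u h u w" "u 0 = 0" "L2_norm (\<lambda>x. f x - u x) < e"
        by (rule maximal_graph_dense[OF Q(1) \<open>f \<in> L2\<close> \<open>0 < e\<close>])
      moreover from this have "(u, h) \<in> T" using \<open>0 \<in> V\<close> unfolding T_def by auto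
      ultimately show "\<exists>u\<in>Domain T. L2_norm (\<lambda>x. f x - u x) < e" by blast
    qed
    moreover have "op_adjoint T = T"
    proof (rule set_eqI, clarify)
      fix g k
      show "(g, k) \<in> op_adjoint T \<longleftrightarrow> (g, k) \<in> T"
      proof
        assume gk: "(g, k) \<in> op_adjoint T"
        \<comment> \<open>Taking adjoints reverses this inclusion. It places \<open>(g, k)\<close>
          in the maximal graph, so that \<open>g\<close> has a boundary value at all.\<close>
        have "minimal_op B Q \<subseteq> T"
        proof clarify
          fix u v assume "(u, v) \<in> minimal_op B Q"
          then obtain F w where "maximal_graph B Q u v F w" "F 0 = 0" by (rule minimal_op_imp_maximal_graph)
          with \<open>0 \<in> V\<close> show "(u, v) \<in> T" by (auto simp: T_def)
        qed
        with gk have "(g, k) \<in> op_adjoint (minimal_op B Q)" by (auto simp: op_adjoint_def)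
        then obtain G z where G: "maximal_graph B Q g k G z" by (auto simp: op_adjoint_minimal_op[OF B Q])
        have "cinner (B *v c) (G 0) = 0" if "c \<in> V" for c
        proof -
          obtain f h F w where F: "maximal_graph B Q f h F w" "F 0 = c" by (rule maximal_graph_with_value[OF Q(1)])
          with adjD[OF gk F(1) _ G] that show ?thesis by simp
        qed
        with lag have "G 0 \<in> V" by blast
        with G show "(g, k) \<in> T" by (auto simp: T_def)
      next
        assume "(g, k) \<in> T"
        then obtain G z where "maximal_graph B Q g k G z" "G 0 \<in> V" by (auto simp: T_def)
        with lag show "(g, k) \<in> op_adjoint T" by (blast intro: adjI)
      qed
    qed
    ultimately show "self_adjoint_op T" by (simp add: self_adjoint_op_def)
  qed
qed

subsection \<open>Block matrices\<close>

lemma sum_UNIV_Plus: "(\<Sum>i\<in>UNIV. f i) = (\<Sum>i\<in>UNIV. f (Inl i)) + (\<Sum>i\<in>UNIV. f (Inr i))"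
  for f :: "('a::finite + 'b::finite) \<Rightarrow> 'c::comm_monoid_add"
  using sum.Plus[of "UNIV :: 'a set" "UNIV :: 'b set" f] by simp

lemma first_part_block_diag: "first_part (block_diag A D *v v) = A *v first_part v"
  by (simp add: vec_eq_iff first_part_def block_diag_def matrix_vector_mult_def sum_UNIV_Plus)

lemma last_part_block_diag: "last_part (block_diag A D *v v) = D *v last_part v"
  by (simp add: vec_eq_iff last_part_def block_diag_def matrix_vector_mult_def sum_UNIV_Plus)

lemma cinner_parts: "cinner u v = cinner (first_part u) (first_part v) + cinner (last_part u) (last_part v)"
  by (simp add: cinner_def first_part_def last_part_def sum_UNIV_Plus)

lemma parts_eqI:
  assumes "first_part u = first_part v" "last_part u = last_part v"
  shows "u = v"
proof -
  have "u $ i = v $ i" for i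
    using assms by (cases i) (simp_all add: vec_eq_iff first_part_def last_part_def)
  then show ?thesis by (simp add: vec_eq_iff)
qed

lemma obtain_parts:
  obtains c :: "complex^('n::finite + 'n)" where "first_part c = x" "last_part c = y"
proof
  let ?c = "\<chi> i. case i of Inl k \<Rightarrow> x $ k | Inr k \<Rightarrow> y $ k"
  show "first_part ?c = x" "last_part ?c = y"
    by (simp_all add: vec_eq_iff first_part_def last_part_def)
qed

lemma self_adjoint_matrix_block_diag:
  assumes "self_adjoint_matrix A" "self_adjoint_matrix D"
  shows "self_adjoint_matrix (block_diag A (- D))"
proof -
  have "cnj (A $ j $ i) = A $ i $ j" "cnj (D $ j $ i) = D $ i $ j" for i j
    using assms unfolding self_adjoint_matrix_def conj_transpose_def by (metis vec_lambda_beta)+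
  then show ?thesis
    by (auto simp: self_adjoint_matrix_def conj_transpose_def block_diag_def vec_eq_iff split: sum.split)
qed

lemma invertible_if_kernel_trivial:
  fixes A :: "complex^'n^'n"
  assumes "\<And>v. A *v v = 0 \<Longrightarrow> v = 0"
  shows "invertible A"
  using assms unfolding invertible_left_inverse matrix_left_invertible_injective vec.inj_iff_eq_0 by blast

lemma positive_definite_cinner_eq_0:
  "positive_definite A \<Longrightarrow> cinner (A *v v) v = 0 \<Longrightarrow> v = 0"
  unfolding positive_definite_def by (metis less_irrefl zero_complex.simps(1))

lemma matrix_inv_cancel:
  fixes A :: "complex^'n^'n"
  assumes "invertible A"
  shows "A *v (matrix_inv A *v v) = v" "matrix_inv A *v (A *v v) = v"
proof -
  have "A ** matrix_inv A = mat 1 \<and> matrix_inv A ** A = mat 1"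
    unfolding matrix_inv_def by (rule someI_ex) (use assms in \<open>simp add: invertible_def\<close>)
  then show "A *v (matrix_inv A *v v) = v" "matrix_inv A *v (A *v v) = v"
    by (simp_all add: matrix_vector_mul_assoc)
qed

text \<open>Vectors of \<open>V\<close> are isotropic, whereas the form is definite on each
  coordinate subspace, so kernel vectors of \<open>H\<^sub>1\<close> and \<open>H\<^sub>2\<close>
  vanish. Once both are invertible, \<open>V\<close> is the graph of \<open>H\<close>, and the
  matrix identity says that the form vanishes on this graph.\<close>

lemma lagrangian_iff:
  fixes B\<^sub>1 B\<^sub>2 H\<^sub>1 H\<^sub>2 :: "complex^'n^'n"
  assumes B1: "self_adjoint_matrix B\<^sub>1" "positive_definite B\<^sub>1"
    and B2: "self_adjoint_matrix B\<^sub>2" "positive_definite B\<^sub>2"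
  defines "V \<equiv> {c. H\<^sub>2 *v last_part c = H\<^sub>1 *v first_part c}"
    and "H \<equiv> matrix_inv H\<^sub>2 ** H\<^sub>1"
  shows "(\<forall>d. d \<in> V \<longleftrightarrow> (\<forall>c\<in>V. cinner (block_diag B\<^sub>1 (- B\<^sub>2) *v c) d = 0)) \<longleftrightarrow>
    invertible H\<^sub>1 \<and> invertible H\<^sub>2 \<and> B\<^sub>1 = conj_transpose H ** B\<^sub>2 ** H"
proof -
  let ?B = "block_diag B\<^sub>1 (- B\<^sub>2)"
  have neg: "(- B\<^sub>2) *v x = - (B\<^sub>2 *v x)" for x by (rule matrix_vector.minus_left)
  have form: "cinner (?B *v c) d =
      cinner (B\<^sub>1 *v first_part c) (first_part d) - cinner (B\<^sub>2 *v last_part c) (last_part d)" for c d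
    unfolding cinner_parts[of _ d] first_part_block_diag last_part_block_diag neg cinner.minus_left by simp
  have H: "cinner (conj_transpose H ** B\<^sub>2 ** H *v x) y = cinner (B\<^sub>2 *v (H *v x)) (H *v y)" for x y
  proof -
    have "conj_transpose (conj_transpose H) = H" by (simp add: conj_transpose_def vec_eq_iff)
    then show ?thesis
      using cinner_matrix_left[of "conj_transpose H" "B\<^sub>2 *v (H *v x)" y]
      by (simp add: matrix_vector_mul_assoc matrix_mul_assoc)
  qed
  have H2: "H\<^sub>2 *v (H *v x) = H\<^sub>1 *v x" if "invertible H\<^sub>2" for x
    by (simp add: H_def matrix_vector_mul_assoc[symmetric] matrix_inv_cancel[OF that])
  show ?thesis
  proof
    assume lag: "\<forall>d. d \<in> V \<longleftrightarrow> (\<forall>c\<in>V. cinner (?B *v c) d = 0)"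
    have "invertible H\<^sub>2"
    proof (rule invertible_if_kernel_trivial)
      fix v assume v: "H\<^sub>2 *v v = 0"
      obtain c where c: "first_part c = 0" "last_part c = v" by (rule obtain_parts)
      with v have "c \<in> V" by (simp add: V_def)
      with lag have "cinner (?B *v c) c = 0" by blast
      with form[of c c] c have "cinner (B\<^sub>2 *v v) v = 0" by (simp add: cinner.zero_right)
      with B2 show "v = 0" by (blast intro: positive_definite_cinner_eq_0)
    qed
    moreover have "invertible H\<^sub>1"
    proof (rule invertible_if_kernel_trivial)
      fix v assume v: "H\<^sub>1 *v v = 0"
      obtain c where c: "first_part c = v" "last_part c = 0" by (rule obtain_parts)
      with v have "c \<in> V" by (simp add: V_def)
      with lag have "cinner (?B *v c) c = 0" by blast
      with form[of c c] c have "cinner (B\<^sub>1 *v v) v = 0" by (simp add: cinner.zero_right)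
      with B1 show "v = 0" by (blast intro: positive_definite_cinner_eq_0)
    qed
    moreover have "B\<^sub>1 *v x = conj_transpose H ** B\<^sub>2 ** H *v x" for x
    proof -
      have "cinner y (B\<^sub>1 *v x - conj_transpose H ** B\<^sub>2 ** H *v x) = 0" for y
      proof -
        obtain c where c: "first_part c = x" "last_part c = H *v x" by (rule obtain_parts)
        obtain d where d: "first_part d = y" "last_part d = H *v y" by (rule obtain_parts)
        have "c \<in> V" "d \<in> V" using c d H2[OF \<open>invertible H\<^sub>2\<close>] by (auto simp: V_def)
        with lag have "cinner (?B *v c) d = 0" by blast
        with form[of c d] c d have "cinner (B\<^sub>1 *v x) y = cinner (B\<^sub>2 *v (H *v x)) (H *v y)" by simp
        then have "cinner (B\<^sub>1 *v x - conj_transpose H ** B\<^sub>2 ** H *v x) y = 0"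
          by (simp add: cinner.diff_left H)
        then show ?thesis by (subst cinner_commute) simp
      qed
      from cinner_eq_0_imp[OF this] show ?thesis by simp
    qed
    ultimately show "invertible H\<^sub>1 \<and> invertible H\<^sub>2 \<and> B\<^sub>1 = conj_transpose H ** B\<^sub>2 ** H"
      by (simp add: matrix_eq)
  next
    assume "invertible H\<^sub>1 \<and> invertible H\<^sub>2 \<and> B\<^sub>1 = conj_transpose H ** B\<^sub>2 ** H"
    then have inv: "invertible H\<^sub>1" "invertible H\<^sub>2" and B: "B\<^sub>1 = conj_transpose H ** B\<^sub>2 ** H" by auto
    have V: "c \<in> V \<longleftrightarrow> last_part c = H *v first_part c" for c
      unfolding V_def mem_Collect_eq H2[OF inv(2), symmetric] by (metis matrix_inv_cancel(2)[OF inv(2)])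
    have form': "cinner (?B *v c) d = cinner (B\<^sub>2 *v last_part c) (H *v first_part d - last_part d)" if "c \<in> V" for c d
    proof -
      have "last_part c = H *v first_part c" using that V by blast
      moreover have "cinner (B\<^sub>1 *v first_part c) (first_part d) = cinner (B\<^sub>2 *v (H *v first_part c)) (H *v first_part d)"
        unfolding B by (rule H)
      ultimately show ?thesis by (simp add: form cinner.diff_right)
    qed
    show "\<forall>d. d \<in> V \<longleftrightarrow> (\<forall>c\<in>V. cinner (?B *v c) d = 0)"
    proof (intro allI iffI ballI)
      fix c d assume "d \<in> V" "c \<in> V"
      then show "cinner (?B *v c) d = 0" using V[of d] by (simp add: form' cinner.zero_right)
    next
      fix d assume d: "\<forall>c\<in>V. cinner (?B *v c) d = 0"
      \<comment> \<open>\<open>z\<close> measures how far \<open>d\<close> is from the graph of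
        \<open>H\<close>. Since \<open>H\<close> is onto, some element of \<open>V\<close> has
        \<open>z\<close> as its last part, and its pairing with \<open>d\<close> is
        \<open>cinner (B\<^sub>2 *v z) z\<close>.\<close>
      define z where "z = H *v first_part d - last_part d"
      define x where "x = matrix_inv H\<^sub>1 *v (H\<^sub>2 *v z)"
      have "H *v x = z"
        by (simp add: H_def x_def matrix_vector_mul_assoc[symmetric] matrix_inv_cancel[OF inv(1)] matrix_inv_cancel[OF inv(2)])
      obtain c where c: "first_part c = x" "last_part c = z" by (rule obtain_parts)
      with \<open>H *v x = z\<close> have "c \<in> V" by (simp add: V)
      with d have "cinner (?B *v c) d = 0" by blast
      with form'[OF \<open>c \<in> V\<close>, of d] c have "cinner (B\<^sub>2 *v z) z = 0" by (simp add: z_def)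
      with B2 have "z = 0" by (blast intro: positive_definite_cinner_eq_0)
      then show "d \<in> V" by (simp add: V z_def)
    qed
  qed
qed

theorem proposition2p1:
  fixes B\<^sub>1 B\<^sub>2 H\<^sub>1 H\<^sub>2 :: "complex^'n^'n"
    and Q :: "real \<Rightarrow> complex^('n + 'n)^('n + 'n)"
  assumes "self_adjoint_matrix B\<^sub>1" and "positive_definite B\<^sub>1"
    and "self_adjoint_matrix B\<^sub>2" and "positive_definite B\<^sub>2"
    and "continuous_on {0..} Q"
    and "\<And>x. x \<ge> 0 \<Longrightarrow> self_adjoint_matrix (Q x)"
  shows "self_adjoint_op (boundary_op (block_diag B\<^sub>1 (- B\<^sub>2)) Q H\<^sub>1 H\<^sub>2) \<longleftrightarrow>
    invertible H\<^sub>1 \<and> invertible H\<^sub>2 \<and>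
    (let H = matrix_inv H\<^sub>2 ** H\<^sub>1 in B\<^sub>1 = conj_transpose H ** B\<^sub>2 ** H)"
proof -
  let ?B = "block_diag B\<^sub>1 (- B\<^sub>2)"
  define V where "V = {c. H\<^sub>2 *v last_part c = H\<^sub>1 *v first_part c}"
  have sa: "self_adjoint_matrix ?B"
    by (intro self_adjoint_matrix_block_diag assms)
  have inv: "invertible ?B"
  proof (rule invertible_if_kernel_trivial)
    fix v assume "?B *v v = 0"
    then have "B\<^sub>1 *v first_part v = 0" "(- B\<^sub>2) *v last_part v = 0"
      unfolding first_part_block_diag[of _ "- B\<^sub>2", symmetric] last_part_block_diag[of B\<^sub>1, symmetric]
      by (simp_all add: first_part_def last_part_def vec_eq_iff)
    then have "cinner (B\<^sub>1 *v first_part v) (first_part v) = 0" "cinner (B\<^sub>2 *v last_part v) (last_part v) = 0"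
      by (simp_all add: cinner.zero_left matrix_vector.minus_left)
    with assms(2,4) have "first_part v = 0" "last_part v = 0"
      by (blast intro: positive_definite_cinner_eq_0)+
    then show "v = 0" by (intro parts_eqI) (simp_all add: first_part_def last_part_def vec_eq_iff)
  qed
  have "0 \<in> V" by (simp add: V_def first_part_def last_part_def matrix_vector_mult_def)
  have "boundary_op ?B Q H\<^sub>1 H\<^sub>2 = {(f, h). \<exists>F w. maximal_graph ?B Q f h F w \<and> F 0 \<in> V}"
    by (auto simp: boundary_op_def V_def op_adjoint_minimal_op[OF sa inv assms(5,6)]
        maximal_graph_value_at_0)
  then have "self_adjoint_op (boundary_op ?B Q H\<^sub>1 H\<^sub>2) \<longleftrightarrow>
      (\<forall>d. d \<in> V \<longleftrightarrow> (\<forall>c\<in>V. cinner (?B *v c) d = 0))"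
    by (simp only: self_adjoint_op_iff_lagrangian[OF sa inv assms(5,6) \<open>0 \<in> V\<close>])
  also have "\<dots> \<longleftrightarrow> invertible H\<^sub>1 \<and> invertible H\<^sub>2 \<and>
      (let H = matrix_inv H\<^sub>2 ** H\<^sub>1 in B\<^sub>1 = conj_transpose H ** B\<^sub>2 ** H)"
    unfolding V_def Let_def by (rule lagrangian_iff[OF assms(1-4)])
  finally show ?thesis .
qed

end
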